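(* The Shabat polynomials of the two trees with passport $[3^2,1^3;2^4,1;9]$ are (up to equivalence) $$P(x)=(x-1)\left(x^4+\frac87x^3+\frac67x^2\left(-\frac57+\frac{6\alpha}{7}\right)+\left(-\frac{40}{49}+\frac{48\alpha}{49}\right)x-\frac{59}{2401}-\frac{156\alpha}{2401}\right)^2,$$ where $\alpha=\pm\sqrt{-3}$, the two choices of sign giving the two trees.
   Context: A Shabat polynomial is a complex polynomial with at most two finite critical values $c_1,c_2$. Its tree is the bicolored plane tree $P^{-1}([c_1,c_2])$, with the two color classes of vertices being the points of $P^{-1}(c_1)$ and of $P^{-1}(c_2)$, edges the connected components of the preimage of the open segment $(c_1,c_2)$, and vertex degree equal to the multiplicity of the corresponding root of $P-c_1$ or $P-c_2$. Two Shabat polynomials are equivalent if they are related by $Q(x)=AP(ax+b)+B$ with $A,a\neq0$, the affine map $y\mapsto Ay+B$ matching the critical values with their colors; bicolored plane trees (up to color- and orientation-preserving isomorphism) correspond bijectively to Shabat polynomials up to equivalence. The passport $[\alpha;\beta;n]$ of a tree with $n$ edges records the degree partitions $\alpha,\beta\vdash n$ of the vertices in the two color classes ($k^m$ means $k$ repeated $m$ times). There are exactly two trees with passport $[3^2,1^3;2^4,1;9]$. In the claim, one critical value is $0$, and the vertices of the class with degrees $[2^4,1]$ are the roots of $P$; the class with degrees $[3^2,1^3]$ lies over the other critical value. *)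

theory Defs
  imports
    "HOL-Analysis.Analysis"
    "HOL-Library.Multiset"
    "HOL-Computational_Algebra.Polynomial"
begin

text \<open>A Shabat polynomial is given together with an ordered pair \<open>c1\<close>, \<open>c2\<close> of distinct values
  containing all its finite critical values; the order fixes the two colors of the vertices of
  its tree.\<close>

definition shabat :: "complex poly \<Rightarrow> complex \<Rightarrow> complex \<Rightarrow> bool" where
  "shabat P c1 c2 \<longleftrightarrow>
     degree P > 0 \<and> c1 \<noteq> c2 \<and> (\<forall>z. poly (pderiv P) z = 0 \<longrightarrow> poly P z \<in> {c1, c2})"

definition shabat_equiv ::
  "complex poly \<Rightarrow> complex \<Rightarrow> complex \<Rightarrow> complex poly \<Rightarrow> complex \<Rightarrow> complex \<Rightarrow> bool" where
  "shabat_equiv P c1 c2 Q d1 d2 \<longleftrightarrow>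
     (\<exists>A B a b. A \<noteq> 0 \<and> a \<noteq> 0 \<and> (\<forall>x. poly Q x = A * poly P (a * x + b) + B) \<and>
        d1 = A * c1 + B \<and> d2 = A * c2 + B)"

text \<open>The tree of \<open>P\<close> is the preimage of the closed segment from \<open>c1\<close> to \<open>c2\<close>, with vertex
  classes \<open>tree_vertices P c1\<close> and \<open>tree_vertices P c2\<close>.\<close>

definition tree_vertices :: "complex poly \<Rightarrow> complex \<Rightarrow> complex set" where
  "tree_vertices P c = {z. poly P z = c}"

definition tree_edges :: "complex poly \<Rightarrow> complex \<Rightarrow> complex \<Rightarrow> complex set set" where
  "tree_edges P c1 c2 = components {z. poly P z \<in> open_segment c1 c2}"

definition vertex_degrees :: "complex poly \<Rightarrow> complex \<Rightarrow> nat multiset" where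
  "vertex_degrees P c = image_mset (\<lambda>z. order z (P - [:c:])) (mset_set (tree_vertices P c))"

definition has_passport ::
  "complex poly \<Rightarrow> complex \<Rightarrow> complex \<Rightarrow> nat multiset \<Rightarrow> nat multiset \<Rightarrow> nat \<Rightarrow> bool" where
  "has_passport P c1 c2 as bs n \<longleftrightarrow>
     degree P = n \<and> vertex_degrees P c1 = as \<and> vertex_degrees P c2 = bs"

text \<open>The plane structure is the counterclockwise cyclic order of the edges around each vertex.
  Edges are analytic arcs, so an edge \<open>e\<close> ending at \<open>v\<close> (that is, with \<open>v \<in> closure e\<close>) has a
  tangent direction there, the unit vector \<open>edge_direction v e\<close>; distinct edges at \<open>v\<close> have
  distinct directions. A vertex of degree 1 has its only edge as its own successor.\<close>

definition edges_at :: "complex poly \<Rightarrow> complex \<Rightarrow> complex \<Rightarrow> complex \<Rightarrow> complex set set" where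
  "edges_at P c1 c2 v = {e \<in> tree_edges P c1 c2. v \<in> closure e}"

definition edge_direction :: "complex \<Rightarrow> complex set \<Rightarrow> complex" where
  "edge_direction v e = Lim (at v within e) (\<lambda>z. sgn (z - v))"

definition ccw_angle :: "complex \<Rightarrow> complex set \<Rightarrow> complex set \<Rightarrow> real" where
  "ccw_angle v e e' = Arg2pi (edge_direction v e' / edge_direction v e)"

definition ccw_next ::
  "complex poly \<Rightarrow> complex \<Rightarrow> complex \<Rightarrow> complex \<Rightarrow> complex set \<Rightarrow> complex set \<Rightarrow> bool" where
  "ccw_next P c1 c2 v e e' \<longleftrightarrow>
     e \<in> edges_at P c1 c2 v \<and> e' \<in> edges_at P c1 c2 v \<and>
     (if edges_at P c1 c2 v = {e} then e' = e
      else e' \<noteq> e \<and> (\<forall>e'' \<in> edges_at P c1 c2 v - {e}. ccw_angle v e e' \<le> ccw_angle v e e''))"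

text \<open>Color- and orientation-preserving isomorphism of bicolored plane trees: bijections between
  the vertices of each color and between the edges, respecting incidence and the counterclockwise
  cyclic orders around the vertices.\<close>

definition tree_iso ::
  "complex poly \<Rightarrow> complex \<Rightarrow> complex \<Rightarrow> complex poly \<Rightarrow> complex \<Rightarrow> complex \<Rightarrow> bool" where
  "tree_iso P c1 c2 Q d1 d2 \<longleftrightarrow>
     (\<exists>f g.
        bij_betw f (tree_vertices P c1) (tree_vertices Q d1) \<and>
        bij_betw f (tree_vertices P c2) (tree_vertices Q d2) \<and>
        bij_betw g (tree_edges P c1 c2) (tree_edges Q d1 d2) \<and>
        (\<forall>v \<in> tree_vertices P c1 \<union> tree_vertices P c2.
           (\<forall>e \<in> tree_edges P c1 c2. e \<in> edges_at P c1 c2 v \<longleftrightarrow> g e \<in> edges_at Q d1 d2 (f v)) \<and>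
           (\<forall>e \<in> tree_edges P c1 c2. \<forall>e' \<in> tree_edges P c1 c2.
              ccw_next P c1 c2 v e e' \<longleftrightarrow> ccw_next Q d1 d2 (f v) (g e) (g e'))))"

definition shabat9 :: "complex \<Rightarrow> complex poly" where
  "shabat9 \<alpha> =
     [:-1, 1:] *
     [: - 59/2401 - 156 * \<alpha> / 2401,
        - 40/49 + 48 * \<alpha> / 49,
        6/7 * (- 5/7 + 6 * \<alpha> / 7),
        8/7,
        1 :] ^ 2"

end

theory Submission
  imports
    Defs
    "HOL-Complex_Analysis.Complex_Analysis"
    "HOL-Computational_Algebra.Fundamental_Theorem_Algebra"
begin

text \<open>Algebra: a polynomial with this passport whose simple root over the second critical value is
  \<open>1\<close> and whose double critical points have midpoint \<open>0\<close> is a multiple of \<open>(x - 1) q\<^sup>2\<close> with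
  \<open>q + 2 (x - 1) q' = 9 (x\<^sup>2 + s)\<^sup>2\<close>. This determines \<open>q\<close> from \<open>s\<close>, and equality of the two
  critical values at the roots of \<open>x\<^sup>2 + s\<close> becomes \<open>s\<^sup>2 (49 s\<^sup>2 + 54 s + 21) = 0\<close>. So there are at most
  two equivalence classes, interchanged by complex conjugation.

  Topology: away from the critical values a polynomial is a covering map, which gives the edges of the
  tree, its local structure at the vertices, and its connectedness. Affine equivalence preserves
  all this. If the tree were isomorphic to its mirror image, composing with complex conjugation
  would give an automorphism reversing all cyclic orders. But the black neighbour of the white
  leaf has degree 3, and an automorphism must fix each of its three edges: otherwise it would
  swap the two edges not leading to the leaf, and the component of the leaf would be too small.
  Fixing three edges is incompatible with reversing their cyclic order.\<close>

subsection \<open>Polynomials as covering maps\<close>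

text \<open>Passing from an isomorphism of trees back to an equivalence of polynomials would
  ordinarily mean reconstructing a polynomial from its tree. Counting avoids this: every polynomial
  with the passport is equivalent to one of the two candidates, equivalence implies isomorphism, and
  the two candidate trees are not isomorphic, so a tree isomorphic to one of them can only come from
  a polynomial equivalent to that one. The differential equation for q arises from two expressions
  for the derivative of k (x - a) q^2: the product rule, and 9 k q times the square of the quadratic
  whose roots are the two vertices of degree 3; the common factor k q cancels. The square root of -3
  enters because 49 s^2 + 54 s + 21 has discriminant -1200 = -3 * 20^2. On the topological side
  edges are components and directions are limits, so even the existence and uniqueness of the ends
  of an edge need proof. This is done for the ends over \<open>c1\<close>; exchanging the colors,
  which leaves the edges unchanged, gives those over \<open>c2\<close>.\<close>

lemma sum_order_eq_degree:
  fixes p :: "complex poly"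
  assumes "p \<noteq> 0"
  shows "(\<Sum>z | poly p z = 0. order z p) = degree p"
proof -
  have "size (proots p) = (\<Sum>z | poly p z = 0. order z p)"
    using assms by (simp add: size_multiset_overloaded_eq)
  then show ?thesis
    by (simp add: size_proots_complex)
qed

lemma pderiv_minus_const [simp]: "pderiv (p - [:c:]) = pderiv (p :: complex poly)"
  by (simp add: pderiv_diff)

lemma minus_const_nonzero:
  assumes "degree p > 0"
  shows "p - [:c:] \<noteq> (0 :: complex poly)"
  using assms by auto

lemma degree_minus_const [simp]: "degree (p - [:c:]) = degree (p :: complex poly)"
proof (cases p)
  case (pCons a q)
  then have "p - [:c:] = pCons (a - c) q" by simp
  then show ?thesis using pCons by simp
qed

lemma finite_fibre:
  assumes "degree p > 0"
  shows "finite {z. poly p z = (c :: complex)}"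
  using poly_roots_finite[OF minus_const_nonzero[OF assms, of c]] by simp

lemma card_noncritical_fibre:
  fixes p :: "complex poly"
  assumes "degree p > 0" "\<And>z. poly p z = w \<Longrightarrow> poly (pderiv p) z \<noteq> 0"
  shows "card {z. poly p z = w} = degree p"
proof -
  let ?q = "p - [:w:]"
  have nz: "?q \<noteq> 0" using minus_const_nonzero[OF assms(1)] .
  have "rsquarefree ?q"
    unfolding rsquarefree_roots using assms(2) by auto
  then have "order z ?q = 1" if "poly p z = w" for z
    using rsquarefree_root_order[of ?q z] nz that by simp
  then have "(\<Sum>z | poly ?q z = 0. order z ?q) = card {z. poly p z = w}"
    by simp
  then show ?thesis
    using sum_order_eq_degree[OF nz] by simp
qed

lemma card_fibre_le:
  fixes p :: "complex poly"
  assumes "degree p > 0"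
  shows "card {z. poly p z = w} \<le> degree p"
  using card_poly_roots_bound[OF minus_const_nonzero[OF assms, of w]] by simp

lemma card_vertices_of_order:
  assumes "degree P > 0"
  shows "card {v \<in> tree_vertices P c. order v (P - [:c:]) = k} = count (vertex_degrees P c) k"
  unfolding vertex_degrees_def tree_vertices_def
  by (subst count_image_mset_eq_card_vimage[OF finite_fibre[OF assms]]) (rule refl)

lemma order_in_vertex_degrees:
  assumes "degree P > 0" "v \<in> tree_vertices P c"
  shows "order v (P - [:c:]) \<in># vertex_degrees P c"
  using assms(2) finite_fibre[OF assms(1), of c] by (auto simp: vertex_degrees_def tree_vertices_def)

text \<open>\<open>P\<close> is locally injective at each point of a noncritical fibre, and the
  intersection of the finitely many image neighbourhoods is evenly covered because no fibre has more
  than \<open>degree P\<close> points. The set \<open>T\<close> will be an open segment for the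
  edges and the plane without two points for connectedness.\<close>

lemma poly_covering_space:
  fixes P :: "complex poly"
  assumes deg: "degree P > 0"
    and noncrit: "\<And>z. poly P z \<in> T \<Longrightarrow> poly (pderiv P) z \<noteq> 0"
  shows "covering_space (poly P -` T) (poly P) T"
proof
  show "continuous_on (poly P -` T) (poly P)"
    by (intro continuous_intros)
  show "poly P ` (poly P -` T) = T"
  proof (intro equalityI subsetI)
    fix w assume "w \<in> T"
    then have "card {z. poly P z = w} = degree P"
      using noncrit by (intro card_noncritical_fibre[OF deg]) auto
    then have "{z. poly P z = w} \<noteq> {}"
      using deg by force
    then show "w \<in> poly P ` (poly P -` T)"
      using \<open>w \<in> T\<close> by auto
  qed auto
next
  fix w assume w: "w \<in> T"
  define Z where "Z = {z. poly P z = w}"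
  have finZ: "finite Z" unfolding Z_def by (rule finite_fibre[OF deg])
  \<comment> \<open>The radius is at most half the distance to the other points of the fibre, so
    balls about different points will be disjoint.\<close>
  have "\<exists>r. 0 < r \<and> open (poly P ` ball z r) \<and> inj_on (poly P) (ball z r)
          \<and> (\<forall>x\<in>Z. x \<noteq> z \<longrightarrow> 2 * r \<le> dist z x)" if z: "z \<in> Z" for z
  proof -
    obtain d where d: "d > 0" "\<And>x. \<lbrakk>x \<in> Z; x \<noteq> z\<rbrakk> \<Longrightarrow> d \<le> dist z x"
      using finite_set_avoid[OF finZ, of z] by blast
    have "deriv (poly P) z = poly (pderiv P) z"
      by (simp add: DERIV_imp_deriv poly_DERIV)
    then have "deriv (poly P) z \<noteq> 0"
      using noncrit z w by (simp add: Z_def)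
    moreover have "poly P holomorphic_on ball z (d/2)"
      by (intro holomorphic_intros)
    ultimately obtain r where r: "r > 0" "ball z r \<subseteq> ball z (d/2)" "open (poly P ` ball z r)" "inj_on (poly P) (ball z r)"
      using has_complex_derivative_locally_invertible[of "poly P" "ball z (d/2)" z] d(1) by auto
    then have "r \<le> d/2"
      using ball_subset_ball_iff[of z r z "d/2"] by auto
    then show ?thesis
      using r d(2) by (intro exI[of _ r]) force
  qed
  then obtain r where r0: "\<And>z. z \<in> Z \<Longrightarrow> 0 < r z"
    and ropen: "\<And>z. z \<in> Z \<Longrightarrow> open (poly P ` ball z (r z))"
    and rinj: "\<And>z. z \<in> Z \<Longrightarrow> inj_on (poly P) (ball z (r z))"
    and rdist: "\<And>z x. \<lbrakk>z \<in> Z; x \<in> Z; x \<noteq> z\<rbrakk> \<Longrightarrow> 2 * r z \<le> dist z x"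
    by metis
  have rdisj: "ball z (r z) \<inter> ball x (r x) = {}" if "z \<in> Z" "x \<in> Z" "x \<noteq> z" for x z
  proof -
    have "r z + r x \<le> dist z x"
      using rdist[OF that] rdist[of x z] that by (auto simp: dist_commute)
    then show ?thesis
      by (rule disjoint_ballI)
  qed
  define V where "V = (\<Inter>z\<in>Z. poly P ` ball z (r z))"
  have cardZ: "card Z = degree P"
    unfolding Z_def using noncrit w by (intro card_noncritical_fibre[OF deg]) auto
  have "open V"
    unfolding V_def using finZ ropen by (intro open_INT) auto
  have wV: "w \<in> V"
  proof (unfold V_def, intro INT_I)
    fix z assume "z \<in> Z"
    then show "w \<in> poly P ` ball z (r z)"
      using r0 by (intro image_eqI[of _ _ z]) (auto simp: Z_def)
  qed
  define W where "W z = ball z (r z) \<inter> poly P -` (V \<inter> T)" for z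
  \<comment> \<open>Each of the \<open>degree P\<close> balls contributes a preimage, so there is no room for others.\<close>
  have cover: "\<exists>z\<in>Z. x \<in> ball z (r z)" if x: "poly P x \<in> V \<inter> T" for x
  proof (rule ccontr)
    assume no: "\<not> (\<exists>z\<in>Z. x \<in> ball z (r z))"
    have "\<forall>z\<in>Z. \<exists>y\<in>ball z (r z). poly P y = poly P x"
    proof
      fix z assume "z \<in> Z"
      then have "poly P x \<in> poly P ` ball z (r z)" using x by (simp only: V_def Int_iff INT_iff)
      then show "\<exists>y\<in>ball z (r z). poly P y = poly P x" by (metis imageE)
    qed
    then obtain y where y: "\<And>z. z \<in> Z \<Longrightarrow> y z \<in> ball z (r z)" "\<And>z. z \<in> Z \<Longrightarrow> poly P (y z) = poly P x"
      by metis
    have injy: "inj_on y Z"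
    proof (rule inj_onI)
      fix a b assume "a \<in> Z" "b \<in> Z" "y a = y b"
      then show "a = b"
        using rdisj[of a b] y(1)[of a] y(1)[of b] by (cases "a = b") auto
    qed
    have "x \<notin> y ` Z"
      using no y(1) by auto
    moreover have "card (y ` Z) = degree P"
      using card_image[OF injy] cardZ by simp
    ultimately have "card (insert x (y ` Z)) = Suc (degree P)"
      using finZ by simp
    moreover have "insert x (y ` Z) \<subseteq> {z. poly P z = poly P x}"
      using y(2) by auto
    ultimately have "Suc (degree P) \<le> card {z. poly P z = poly P x}"
      using card_mono[OF finite_fibre[OF deg]] by metis
    then show False
      using card_fibre_le[OF deg, of "poly P x"] by simp
  qed
  have homeo: "\<exists>q. homeomorphism (W z) (V \<inter> T) (poly P) q" if z: "z \<in> Z" for z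
  proof -
    define g where "g = inv_into (ball z (r z)) (poly P)"
    have g: "continuous_on (poly P ` ball z (r z)) g"
       "\<And>x. x \<in> ball z (r z) \<Longrightarrow> g (poly P x) = x"
      using rinj[OF z] by (auto simp: g_def intro!: continuous_on_inverse_open continuous_intros)
    have VP: "V \<subseteq> poly P ` ball z (r z)" using z by (auto simp: V_def)
    have "homeomorphism (W z) (V \<inter> T) (poly P) g"
    proof (rule homeomorphismI)
      show "continuous_on (W z) (poly P)" by (intro continuous_intros)
      show "continuous_on (V \<inter> T) g"
        by (rule continuous_on_subset[OF g(1)]) (use VP in blast)
      show "poly P ` W z \<subseteq> V \<inter> T" by (auto simp: W_def)
      show "g ` (V \<inter> T) \<subseteq> W z"
      proof safe
        fix v assume "v \<in> V" "v \<in> T"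
        then obtain x where "x \<in> ball z (r z)" "v = poly P x" using VP by blast
        then show "g v \<in> W z" using g(2) \<open>v \<in> V\<close> \<open>v \<in> T\<close> by (auto simp: W_def)
      qed
      show "g (poly P x) = x" if "x \<in> W z" for x using that g(2) by (auto simp: W_def)
      show "poly P (g v) = v" if "v \<in> V \<inter> T" for v
      proof -
        have "v \<in> poly P ` ball z (r z)" using that VP by blast
        then show ?thesis unfolding g_def by (rule f_inv_into_f)
      qed
    qed
    then show ?thesis by blast
  qed
  show "\<exists>U. w \<in> U \<and> openin (top_of_set T) U \<and>
            (\<exists>v. \<Union> v = poly P -` T \<inter> poly P -` U \<and>
                 (\<forall>u\<in>v. openin (top_of_set (poly P -` T)) u) \<and>
                 pairwise disjnt v \<and> (\<forall>u\<in>v. \<exists>q. homeomorphism u U (poly P) q))"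
  proof (intro exI[of _ "V \<inter> T"] conjI exI[of _ "W ` Z"])
    show "w \<in> V \<inter> T" using wV w by simp
    show "openin (top_of_set T) (V \<inter> T)"
      using \<open>open V\<close> by (simp add: openin_open_Int Int_commute)
    show "\<Union> (W ` Z) = poly P -` T \<inter> poly P -` (V \<inter> T)"
    proof (intro equalityI subsetI)
      fix x assume x: "x \<in> poly P -` T \<inter> poly P -` (V \<inter> T)"
      then obtain z where "z \<in> Z" "x \<in> ball z (r z)" using cover by auto
      then show "x \<in> \<Union> (W ` Z)" using x by (auto simp: W_def)
    qed (auto simp: W_def)
    show "\<forall>u\<in>W ` Z. openin (top_of_set (poly P -` T)) u"
    proof
      fix u assume "u \<in> W ` Z"
      then obtain z where "z \<in> Z" "u = W z" by auto
      then have "u = poly P -` T \<inter> (ball z (r z) \<inter> poly P -` V)"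
        by (auto simp: W_def)
      moreover have "open (poly P -` V)"
        by (intro open_vimage \<open>open V\<close> continuous_intros)
      ultimately show "openin (top_of_set (poly P -` T)) u"
        by (metis open_Int open_ball openin_open_Int)
    qed
    show "pairwise disjnt (W ` Z)"
    proof (rule pairwiseI)
      fix a b assume "a \<in> W ` Z" "b \<in> W ` Z" "a \<noteq> b"
      then obtain z x where "z \<in> Z" "x \<in> Z" "x \<noteq> z" "a = W z" "b = W x" by auto
      then show "disjnt a b" using rdisj[of z x] by (auto simp: W_def disjnt_def)
    qed
    show "\<forall>u\<in>W ` Z. \<exists>q. homeomorphism u (V \<inter> T) (poly P) q"
      using homeo by auto
  qed
qed

subsection \<open>Edges, vertices and connectedness of the tree\<close>

text \<open>Properness, from the growth of \<open>P\<close> at infinity. It provides the limit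
  points that become ends of edges, and the compactness behind the nested intersection for the
  tree.\<close>

lemma compact_poly_vimage:
  fixes P :: "complex poly"
  assumes "degree P > 0" "compact S"
  shows "compact (poly P -` S)"
proof -
  have "filterlim (poly P) at_infinity at_infinity"
    by (rule filterlim_poly_at_infinity[OF assms(1)])
  moreover obtain B where B: "\<And>w. w \<in> S \<Longrightarrow> norm w \<le> B"
    using compact_imp_bounded[OF assms(2)] unfolding bounded_iff by blast
  ultimately have "eventually (\<lambda>z. norm (poly P z) \<ge> B + 1) at_infinity"
    unfolding filterlim_at_infinity_conv_norm_at_top filterlim_at_top by blast
  then obtain R where R: "\<And>z. norm z \<ge> R \<Longrightarrow> norm (poly P z) \<ge> B + 1"
    unfolding eventually_at_infinity by auto
  have "norm z \<le> R" if "z \<in> poly P -` S" for z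
    using R[of z] B[of "poly P z"] that by (cases "R \<le> norm z") auto
  then have "bounded (poly P -` S)"
    unfolding bounded_iff by blast
  moreover have "closed (poly P -` S)"
    by (intro closed_vimage compact_imp_closed assms continuous_intros)
  ultimately show ?thesis
    using compact_eq_bounded_closed by blast
qed

section \<open>Edges as lifts of the open segment, and their ends\<close>

locale shabat_tree =
  fixes P :: "complex poly" and c1 c2 :: complex
  assumes shabat: "shabat P c1 c2"
begin

lemma degree_pos: "degree P > 0"
  using shabat by (simp add: shabat_def)

lemma colors_distinct: "c1 \<noteq> c2"
  using shabat by (simp add: shabat_def)

lemma noncritical: "\<lbrakk>poly P z \<noteq> c1; poly P z \<noteq> c2\<rbrakk> \<Longrightarrow> poly (pderiv P) z \<noteq> 0"
  using shabat by (auto simp: shabat_def)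

lemma swap: "shabat_tree P c2 c1"
  using shabat by unfold_locales (auto simp: shabat_def)

lemma tree_edges_swap: "tree_edges P c2 c1 = tree_edges P c1 c2"
  by (simp add: tree_edges_def open_segment_commute)

lemma edges_at_swap: "edges_at P c2 c1 = edges_at P c1 c2"
  by (simp add: edges_at_def tree_edges_swap fun_eq_iff)

lemma poly_on_edge_in_segment:
  assumes "e \<in> tree_edges P c1 c2" "z \<in> e"
  shows "poly P z \<in> open_segment c1 c2"
  using in_components_subset[of e] assms by (auto simp: tree_edges_def)

lemma finite_vertices: "finite (tree_vertices P c)"
  unfolding tree_vertices_def by (rule finite_fibre[OF degree_pos])

text \<open>The open segment is simply connected and contains no critical value, so it lifts to a
  section through a chosen point of \<open>e\<close>. Hence \<open>P\<close> maps each edge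
  homeomorphically onto the open segment.\<close>

lemma edge_section:
  assumes e: "e \<in> tree_edges P c1 c2"
  obtains g where "continuous_on (open_segment c1 c2) g" "g ` open_segment c1 c2 = e"
    "\<And>z. z \<in> e \<Longrightarrow> g (poly P z) = z" "\<And>w. w \<in> open_segment c1 c2 \<Longrightarrow> poly P (g w) = w"
proof -
  let ?S = "open_segment c1 c2"
  have cov: "covering_space (poly P -` ?S) (poly P) ?S"
    using noncritical by (intro poly_covering_space[OF degree_pos]) (auto simp: open_segment_def)
  have e': "e \<in> components (poly P -` ?S)"
    using e by (simp add: tree_edges_def vimage_def)
  then have sub: "e \<subseteq> poly P -` ?S" and "e \<noteq> {}" and "connected e"
    using in_components_subset in_components_nonempty in_components_connected by blast+
  then obtain a where a: "a \<in> e" by blast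
  have conv: "convex ?S" by simp
  obtain g where g: "continuous_on ?S g" "g \<in> ?S \<rightarrow> poly P -` ?S" "g (poly P a) = a"
    "\<And>y. y \<in> ?S \<Longrightarrow> poly P (g y) = y"
  proof (rule covering_space_lift_strong[OF cov, of a "poly P a" ?S id])
    show "a \<in> poly P -` ?S" "poly P a \<in> ?S" using sub a by auto
  qed (auto intro: convex_imp_simply_connected[OF conv] convex_imp_locally_path_connected[OF conv])
  \<comment> \<open>On the connected set \<open>e\<close>, both \<open>g \<circ> poly P\<close> and
    the identity lift \<open>poly P\<close>, and they agree at \<open>a\<close>.\<close>
  have "g (poly P z) = z" if "z \<in> e" for z
  proof -
    have "continuous_on e (g \<circ> poly P)"
      using sub by (intro continuous_on_compose continuous_on_subset[OF g(1)] continuous_intros) auto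
    then have "(g \<circ> poly P) z = id z"
      using a that sub \<open>connected e\<close> g
      by - (rule covering_space_lift_unique[OF cov, where f="poly P" and T=e and a=a],
            auto simp: Pi_iff intro: continuous_on_poly)
    then show ?thesis by simp
  qed
  moreover have "g ` ?S \<subseteq> e"
  proof (rule components_maximal[OF e'])
    show "connected (g ` ?S)"
      by (intro connected_continuous_image g convex_connected conv)
    show "g ` ?S \<subseteq> poly P -` ?S"
      using g(2) by auto
    show "e \<inter> g ` ?S \<noteq> {}"
      using a g(3) sub by (metis IntI empty_iff image_eqI subsetD vimageD)
  qed
  moreover have "e \<subseteq> g ` ?S"
    using sub calculation(1) by (metis image_eqI subsetD subsetI vimageD)
  ultimately show ?thesis
    by (intro that[OF g(1)] g(4)) auto
qed

lemma edge_inj: "e \<in> tree_edges P c1 c2 \<Longrightarrow> inj_on (poly P) e"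
  by (metis edge_section inj_on_inverseI)

lemma edge_image:
  assumes "e \<in> tree_edges P c1 c2"
  shows "poly P ` e = open_segment c1 c2"
proof -
  obtain g where "g ` open_segment c1 c2 = e" "\<And>w. w \<in> open_segment c1 c2 \<Longrightarrow> poly P (g w) = w"
    using edge_section[OF assms] by metis
  then show ?thesis by force
qed

lemma closure_edge_in_vimage:
  assumes "e \<in> tree_edges P c1 c2"
  shows "closure e \<subseteq> poly P -` closed_segment c1 c2"
proof (rule closure_minimal)
  show "e \<subseteq> poly P -` closed_segment c1 c2"
    using edge_image[OF assms] segment_open_subset_closed by fastforce
  show "closed (poly P -` closed_segment c1 c2)"
    by (intro closed_vimage continuous_intros) auto
qed

text \<open>A component is closed relative to the whole preimage of the open segment, so closing an
  edge can only add points over \<open>c1\<close> or \<open>c2\<close>.\<close>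

lemma closure_edge:
  assumes e: "e \<in> tree_edges P c1 c2" and z: "z \<in> closure e" "poly P z \<in> open_segment c1 c2"
  shows "z \<in> e"
proof -
  have "closedin (top_of_set {z. poly P z \<in> open_segment c1 c2}) e"
    using e closedin_component by (auto simp: tree_edges_def)
  then show ?thesis
    using z by (metis (lifting) closedin_closed_eq closedin_limpt closure_def UnE mem_Collect_eq)
qed

lemma closure_edge_cases:
  assumes "e \<in> tree_edges P c1 c2" "z \<in> closure e"
  shows "z \<in> e \<or> poly P z = c1 \<or> poly P z = c2"
  using closure_edge[OF assms] closure_edge_in_vimage[OF assms(1)] assms(2)
  by (auto simp: open_segment_def)

lemma edge_through:
  assumes "poly P z \<in> open_segment c1 c2"
  obtains e where "e \<in> tree_edges P c1 c2" "z \<in> e"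
proof -
  have "z \<in> \<Union> (components {z. poly P z \<in> open_segment c1 c2})"
    using assms Union_components[of "{z. poly P z \<in> open_segment c1 c2}"] by blast
  then show ?thesis using that by (metis UnionE tree_edges_def)
qed

lemma edge_eqI:
  assumes "e \<in> tree_edges P c1 c2" "e' \<in> tree_edges P c1 c2" "z \<in> e" "z \<in> e'"
  shows "e = e'"
  using assms components_eq[of e _ e'] by (auto simp: tree_edges_def)

text \<open>Follow the edge towards \<open>c1\<close>: its points over a sequence tending to
  \<open>c1\<close> stay in a compact set, and the limit of a subsequence is the vertex.\<close>

lemma edge_exists_endpoint:
  assumes e: "e \<in> tree_edges P c1 c2"
  obtains v where "v \<in> tree_vertices P c1" "e \<in> edges_at P c1 c2 v"
proof -
  obtain g where g: "g ` open_segment c1 c2 = e"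
     "\<And>w. w \<in> open_segment c1 c2 \<Longrightarrow> poly P (g w) = w"
    using edge_section[OF e] by metis
  \<comment> \<open>Two successors keep the parameter at most 1/2; with only one, the first point
    would be \<open>c2\<close>, outside the open segment.\<close>
  define w where "w n = c1 + of_real (inverse (real (Suc (Suc n)))) * (c2 - c1)" for n
  have w_in: "w n \<in> open_segment c1 c2" for n
    unfolding in_segment(2)
  proof (intro conjI colors_distinct exI[of _ "inverse (real (Suc (Suc n)))"])
    show "w n = (1 - inverse (real (Suc (Suc n)))) *\<^sub>R c1 + inverse (real (Suc (Suc n))) *\<^sub>R c2"
      unfolding w_def scaleR_conv_of_real by (simp only: of_real_diff of_real_1) (simp add: algebra_simps)
  qed (auto simp: field_simps)
  have "(\<lambda>n. inverse (real (Suc (Suc n)))) \<longlonglongrightarrow> 0"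
    using LIMSEQ_Suc[OF LIMSEQ_inverse_real_of_nat] by simp
  then have "(\<lambda>n. of_real (inverse (real (Suc (Suc n))))) \<longlonglongrightarrow> complex_of_real 0"
    by (rule tendsto_of_real)
  then have "w \<longlonglongrightarrow> c1 + complex_of_real 0 * (c2 - c1)"
    unfolding w_def by (intro tendsto_add tendsto_mult tendsto_const)
  then have w_lim: "w \<longlonglongrightarrow> c1"
    by simp
  have "seq_compact (poly P -` closed_segment c1 c2)"
    by (intro compact_imp_seq_compact compact_poly_vimage degree_pos) auto
  moreover have gw_in: "\<forall>n. g (w n) \<in> poly P -` closed_segment c1 c2"
    using g(2)[OF w_in] w_in segment_open_subset_closed by (metis subsetD vimageI2)
  ultimately obtain l r where l: "strict_mono r" "((\<lambda>n. g (w n)) \<circ> r) \<longlonglongrightarrow> l"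
    by (rule seq_compactE)
  have "(\<lambda>n. poly P (((\<lambda>n. g (w n)) \<circ> r) n)) \<longlonglongrightarrow> poly P l"
    by (intro tendsto_poly l)
  then have "(w \<circ> r) \<longlonglongrightarrow> poly P l"
    using g(2)[OF w_in] by (simp add: o_def)
  then have "poly P l = c1"
    by (rule LIMSEQ_unique[OF _ LIMSEQ_subseq_LIMSEQ[OF w_lim l(1)]])
  moreover have "l \<in> closure e"
    unfolding closure_sequential using l(2) g(1) w_in by (intro exI[of _ "(\<lambda>n. g (w n)) \<circ> r"]) auto
  ultimately show ?thesis
    using e that by (auto simp: tree_vertices_def edges_at_def)
qed

end

section \<open>Local coordinates and the edges around a vertex\<close>

text \<open>With m the order at \<open>v\<close>, p - c = (z - v)^m R where R does not vanish at
  \<open>v\<close>, and \<open>k\<close> is an m-th root of R / d near \<open>v\<close>. The factor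
  \<open>k\<close> is kept apart because it relates the direction of \<phi> to that of z - v. Later
  \<open>d\<close> is c2 - c1, so that points over the open segment are those where \<phi>^m is real
  and between 0 and 1.\<close>

lemma poly_local_coordinate:
  fixes p :: "complex poly"
  assumes deg: "degree p > 0" and pv: "poly p v = c" and d: "d \<noteq> 0" and \<epsilon>: "\<epsilon> > 0"
  obtains k \<phi> \<rho> N where "0 < \<rho>" "\<rho> < 1" "open N" "v \<in> N" "N \<subseteq> ball v \<epsilon>"
    "continuous_on N k" "\<And>z. z \<in> N \<Longrightarrow> k z \<noteq> 0" "\<And>z. \<phi> z = (z - v) * k z"
    "inj_on \<phi> N" "\<phi> ` N = ball 0 \<rho>" "continuous_on (ball 0 \<rho>) (inv_into N \<phi>)"
    "\<And>z. z \<in> N \<Longrightarrow> poly p z = c + d * \<phi> z ^ order v (p - [:c:])"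
proof -
  let ?q = "p - [:c:]"
  define m where "m = order v ?q"
  have nz: "?q \<noteq> 0" by (rule minus_const_nonzero[OF deg])
  have mpos: "m > 0"
    using order_root[of ?q v] nz pv by (simp add: m_def)
  obtain R where R: "?q = [:- v, 1:] ^ m * R" "\<not> [:- v, 1:] dvd R"
    using order_decomp[OF nz] by (auto simp: m_def)
  have Rv: "poly R v \<noteq> 0"
    using R(2) by (simp add: poly_eq_0_iff_dvd)
  have "open {z. poly R z \<noteq> 0}"
    by (intro open_Collect_neq continuous_intros)
  then obtain r where r: "r > 0" "ball v r \<subseteq> {z. poly R z \<noteq> 0}"
    using Rv open_contains_ball by (metis (mono_tags, lifting) mem_Collect_eq)
  obtain l where l: "l holomorphic_on ball v r" "\<And>z. z \<in> ball v r \<Longrightarrow> exp (l z) = poly R z / d"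
  proof (rule holomorphic_logarithm_exists[of "ball v r" "\<lambda>z. poly R z / d" v])
    show "(\<lambda>z. poly R z / d) holomorphic_on ball v r"
      using d by (intro holomorphic_intros)
    show "poly R z / d \<noteq> 0" if "z \<in> ball v r" for z using that r(2) d by auto
  qed (use r(1) in auto)
  define k where "k z = exp (l z / of_nat m)" for z
  define \<phi> where "\<phi> z = (z - v) * k z" for z
  have k_hol: "k holomorphic_on ball v r"
    unfolding k_def using mpos by (intro holomorphic_intros l) auto
  then have \<phi>_hol: "\<phi> holomorphic_on ball v r"
    unfolding \<phi>_def by (intro holomorphic_intros)
  have k_pow: "k z ^ m = poly R z / d" if "z \<in> ball v r" for z
    using l(2)[OF that] mpos by (simp add: k_def exp_of_nat_mult[symmetric])
  have p_eq: "poly p z = c + d * \<phi> z ^ m" if "z \<in> ball v r" for z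
  proof -
    have "poly p z - c = (z - v) ^ m * poly R z"
      using arg_cong[OF R(1), of "\<lambda>q. poly q z"] by (simp add: poly_power algebra_simps)
    then show ?thesis
      using k_pow[OF that] d by (simp add: \<phi>_def power_mult_distrib diff_eq_eq)
  qed
  have "(k has_field_derivative deriv k v) (at v)"
    using k_hol r(1) by (intro holomorphic_derivI[of _ "ball v r"]) auto
  then have "(\<phi> has_field_derivative k v) (at v)"
    unfolding \<phi>_def by (auto intro!: derivative_eq_intros)
  then have deriv_nz: "deriv \<phi> v \<noteq> 0"
    by (simp add: DERIV_imp_deriv k_def)
  obtain s where s: "s > 0" "ball v s \<subseteq> ball v (min r \<epsilon>)" "open (\<phi> ` ball v s)" "inj_on \<phi> (ball v s)"
  proof (rule has_complex_derivative_locally_invertible[of \<phi> "ball v (min r \<epsilon>)" v])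
    show "\<phi> holomorphic_on ball v (min r \<epsilon>)"
      by (rule holomorphic_on_subset[OF \<phi>_hol]) auto
  qed (use r(1) \<epsilon> deriv_nz in auto)
  have cont: "continuous_on (ball v s) \<phi>"
    using s(2) by (intro holomorphic_on_imp_continuous_on holomorphic_on_subset[OF \<phi>_hol]) auto
  have "\<phi> v = 0" by (simp add: \<phi>_def)
  then have "0 \<in> \<phi> ` ball v s" using s(1) by (metis centre_in_ball image_eqI)
  then obtain \<rho>' where \<rho>': "\<rho>' > 0" "ball 0 \<rho>' \<subseteq> \<phi> ` ball v s"
    using s(3) open_contains_ball by metis
  \<comment> \<open>A radius below 1 keeps \<phi>^m below 1 in modulus, so rays from
    \<open>v\<close> stop short of the values near \<open>c2\<close>.\<close>
  define \<rho> where "\<rho> = min \<rho>' (1/2)"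
  have \<rho>: "0 < \<rho>" "\<rho> < 1" "ball 0 \<rho> \<subseteq> \<phi> ` ball v s"
    using \<rho>' by (auto simp: \<rho>_def)
  define N where "N = ball v s \<inter> \<phi> -` ball 0 \<rho>"
  have "open N"
    unfolding N_def using continuous_on_open_vimage[of "ball v s" \<phi>] cont by (simp add: Int_commute)
  have Nsub: "N \<subseteq> ball v s" by (auto simp: N_def)
  have injN: "inj_on \<phi> N" using s(4) Nsub inj_on_subset by blast
  have img: "\<phi> ` N = ball 0 \<rho>"
    using \<rho>(3) unfolding N_def by blast
  show ?thesis
  proof (rule that[of \<rho> N k \<phi>])
    show "v \<in> N" using s(1) \<rho>(1) \<open>\<phi> v = 0\<close> by (simp add: N_def)
    show "N \<subseteq> ball v \<epsilon>" using Nsub s(2) by auto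
    show "continuous_on N k"
      using Nsub s(2) by (intro holomorphic_on_imp_continuous_on holomorphic_on_subset[OF k_hol]) auto
    show "continuous_on (ball 0 \<rho>) (inv_into N \<phi>)"
      using continuous_on_inverse_open[of N \<phi> "inv_into N \<phi>"] \<open>open N\<close> injN continuous_on_subset[OF cont Nsub] img
      by simp
    show "poly p z = c + d * \<phi> z ^ order v (p - [:c:])" if "z \<in> N" for z
      using p_eq[of z] that Nsub s(2) by (auto simp: m_def)
  qed (use \<rho> \<open>open N\<close> injN img in \<open>auto simp: k_def \<phi>_def\<close>)
qed

lemma open_segment_iff_affine:
  fixes c1 c2 :: complex
  assumes "c1 \<noteq> c2"
  shows "w \<in> open_segment c1 c2 \<longleftrightarrow> (\<exists>t. 0 < t \<and> t < 1 \<and> w = c1 + (c2 - c1) * of_real t)"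
proof -
  have "(1 - t) *\<^sub>R c1 + t *\<^sub>R c2 = c1 + (c2 - c1) * of_real t" for t
    by (simp add: scaleR_conv_of_real algebra_simps)
  then show ?thesis
    using assms by (auto simp: in_segment(2))
qed

context shabat_tree
begin

text \<open>Near \<open>v\<close> the polynomial is \<open>c1 + (c2 - c1) \<phi>\<^sup>m\<close> in a local coordinate \<open>\<phi>\<close>; \<open>E \<omega>\<close> is the edge leaving \<open>v\<close>
  along the ray of \<open>\<phi>\<close>-direction \<open>\<omega>\<close>, and \<open>u\<close> is the direction of \<open>\<phi>'(v)\<close>.\<close>

lemma vertex_star:
  assumes v: "v \<in> tree_vertices P c1" and \<epsilon>: "\<epsilon> > 0"
  shows "\<exists>u \<delta> E. u \<noteq> 0 \<and> \<delta> > 0 \<and>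
    bij_betw E {\<omega>. \<omega> ^ order v (P - [:c1:]) = 1} (edges_at P c1 c2 v) \<and>
    (\<forall>\<omega>. \<omega> ^ order v (P - [:c1:]) = 1 \<longrightarrow>
       v islimpt E \<omega> \<and> ((\<lambda>z. sgn (z - v)) \<longlongrightarrow> \<omega> / u) (at v within E \<omega>) \<and>
       (\<forall>z \<in> E \<omega>. dist (poly P z) c1 < \<delta> \<longrightarrow> z \<in> ball v \<epsilon>))"
proof -
  define m where "m = order v (P - [:c1:])"
  let ?d = "c2 - c1"
  let ?S = "{z. poly P z \<in> open_segment c1 c2}"
  have Pv: "poly P v = c1" using v by (simp add: tree_vertices_def)
  have d: "?d \<noteq> 0" using colors_distinct by simp
  have mpos: "m > 0"
    using order_root[of "P - [:c1:]" v] minus_const_nonzero[OF degree_pos, of c1] Pv by (simp add: m_def)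
  obtain k \<phi> \<rho> N where \<rho>: "0 < \<rho>" "\<rho> < 1" and N: "open N" "v \<in> N" "N \<subseteq> ball v \<epsilon>"
    and k: "continuous_on N k" "\<And>z. z \<in> N \<Longrightarrow> k z \<noteq> 0" and \<phi>: "\<And>z. \<phi> z = (z - v) * k z"
    and inj\<phi>: "inj_on \<phi> N" and im\<phi>: "\<phi> ` N = ball 0 \<rho>"
    and cont\<psi>: "continuous_on (ball 0 \<rho>) (inv_into N \<phi>)"
    and P_eq: "\<And>z. z \<in> N \<Longrightarrow> poly P z = c1 + ?d * \<phi> z ^ m"
    unfolding m_def by (rule poly_local_coordinate[OF degree_pos Pv d \<epsilon>]) blast
  define \<psi> where "\<psi> = inv_into N \<phi>"
  have \<psi>N: "\<psi> x \<in> N" and \<phi>\<psi>: "\<phi> (\<psi> x) = x" if "x \<in> ball 0 \<rho>" for x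
    using that unfolding \<psi>_def im\<phi>[symmetric] by (auto intro: inv_into_into f_inv_into_f)
  have \<psi>\<phi>: "\<psi> (\<phi> z) = z" if "z \<in> N" for z
    using that inj\<phi> by (simp add: \<psi>_def)
  have unit: "norm \<omega> = 1" if "\<omega> ^ m = 1" for \<omega> :: complex
    using that mpos by (metis norm_one norm_power norm_ge_zero power_eq_1_iff less_numeral_extra(3))
  \<comment> \<open>A ray is a radius in the coordinate \<phi>. If \<omega> is an m-th root of
    unity, the value of \<open>P\<close> at radius r is c1 + (c2 - c1) r^m, so the ray lies over the
    segment.\<close>
  define ray where "ray \<omega> = (\<lambda>r. \<psi> (of_real r * \<omega>)) ` {0<..<\<rho>}" for \<omega>
  have in_ball: "of_real r * \<omega> \<in> ball 0 \<rho>" if "\<omega> ^ m = 1" "0 \<le> r" "r < \<rho>" for \<omega> :: complex and r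
    using that unit by (simp add: norm_mult)
  have P_ray: "poly P (\<psi> (of_real r * \<omega>)) = c1 + ?d * of_real (r ^ m)"
    if "\<omega> ^ m = 1" "0 < r" "r < \<rho>" for \<omega> r
    using P_eq[OF \<psi>N[OF in_ball[of \<omega> r]]] \<phi>\<psi>[OF in_ball[of \<omega> r]] that by (simp add: power_mult_distrib)
  have ray_sub: "ray \<omega> \<subseteq> ?S" if \<omega>: "\<omega> ^ m = 1" for \<omega>
  proof
    fix z assume "z \<in> ray \<omega>"
    then obtain r where r: "0 < r" "r < \<rho>" "z = \<psi> (of_real r * \<omega>)"
      by (auto simp: ray_def)
    have "r ^ m < 1"
      using r \<rho> mpos by (simp add: power_less_one_iff)
    then show "z \<in> ?S"
      using r P_ray[OF \<omega> r(1,2)] open_segment_iff_affine[OF colors_distinct]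
      by (metis (mono_tags, lifting) mem_Collect_eq zero_less_power)
  qed
  have ray_conn: "connected (ray \<omega>)" if \<omega>: "\<omega> ^ m = 1" for \<omega>
    unfolding ray_def
  proof (rule connected_continuous_image)
    show "continuous_on {0<..<\<rho>} (\<lambda>r. \<psi> (of_real r * \<omega>))"
    proof (rule continuous_on_compose2[OF cont\<psi>[folded \<psi>_def]])
      show "continuous_on {0<..<\<rho>} (\<lambda>r. of_real r * \<omega>)" by (intro continuous_intros)
    qed (use in_ball[OF \<omega>] in auto)
  qed auto
  \<comment> \<open>The whole ray lies in the component of its midpoint. The common radius allows
    different rays to be compared over the same value of \<open>P\<close>.\<close>
  define E where "E \<omega> = connected_component_set ?S (\<psi> (of_real (\<rho>/2) * \<omega>))" for \<omega>
  have base: "\<psi> (of_real (\<rho>/2) * \<omega>) \<in> ray \<omega>" for \<omega>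
    unfolding ray_def using \<rho> by (intro image_eqI[of _ _ "\<rho>/2"]) auto
  have E_edge: "E \<omega> \<in> tree_edges P c1 c2" if "\<omega> ^ m = 1" for \<omega>
    unfolding E_def tree_edges_def using ray_sub[OF that] base by (intro componentsI) blast
  have ray_E: "ray \<omega> \<subseteq> E \<omega>" if "\<omega> ^ m = 1" for \<omega>
    unfolding E_def by (rule connected_component_maximal[OF base ray_conn[OF that] ray_sub[OF that]])
  \<comment> \<open>Over the open segment \<phi>^m is a positive real number, so \<phi> divided by
    its modulus is a root of unity.\<close>
  have ray_through: "\<exists>\<omega>. \<omega> ^ m = 1 \<and> z \<in> ray \<omega>" if z: "z \<in> N" "z \<in> ?S" for z
  proof -
    obtain t where t: "0 < t" "t < 1" "poly P z = c1 + ?d * of_real t"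
      using z(2) open_segment_iff_affine[OF colors_distinct] by auto
    have pow: "\<phi> z ^ m = of_real t"
      using t(3) P_eq[OF z(1)] d by simp
    define r where "r = norm (\<phi> z)"
    have rm: "r ^ m = t"
      using pow t(1) by (metis r_def norm_power norm_of_real abs_of_pos)
    have "r \<noteq> 0" using rm t(1) mpos by (metis power_0_left less_irrefl)
    then have "r > 0" by (simp add: r_def)
    have "\<phi> z \<in> ball 0 \<rho>" using z(1) im\<phi> by blast
    then have "r < \<rho>" by (simp add: r_def)
    have eq: "\<phi> z = of_real r * (\<phi> z / of_real r)"
      using \<open>r > 0\<close> by simp
    have "(\<phi> z / of_real r) ^ m = 1"
      using pow rm t(1) by (simp add: power_divide flip: of_real_power)
    moreover have "z \<in> ray (\<phi> z / of_real r)"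
      unfolding ray_def using \<open>r > 0\<close> \<open>r < \<rho>\<close> \<psi>\<phi>[OF z(1)] eq by (intro image_eqI[of _ _ r]) auto
    ultimately show ?thesis by blast
  qed
  \<comment> \<open>One edge cannot leave \<open>v\<close> along two rays: their points at radius
    \<rho>/2 have the same value, and \<open>P\<close> is injective on an edge.\<close>
  have E_inj: "\<omega> = \<omega>'" if "\<omega> ^ m = 1" "\<omega>' ^ m = 1" "E \<omega> = E \<omega>'" for \<omega> \<omega>'
  proof -
    have half: "0 < \<rho>/2" "\<rho>/2 < \<rho>" using \<rho> by auto
    have "\<psi> (of_real (\<rho>/2) * \<omega>) = \<psi> (of_real (\<rho>/2) * \<omega>')"
    proof (rule inj_onD[OF edge_inj[OF E_edge[OF that(1)]]])
      show "poly P (\<psi> (of_real (\<rho>/2) * \<omega>)) = poly P (\<psi> (of_real (\<rho>/2) * \<omega>'))"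
        using P_ray[OF that(1) half] P_ray[OF that(2) half] by simp
    qed (use base ray_E that in blast)+
    then have "of_real (\<rho>/2) * \<omega> = of_real (\<rho>/2) * \<omega>'"
      using \<phi>\<psi> in_ball that half by (metis less_imp_le)
    then show ?thesis using \<rho> by simp
  qed
  have E_N: "z \<in> ray \<omega>" if \<omega>: "\<omega> ^ m = 1" and z: "z \<in> E \<omega>" "z \<in> N" for \<omega> z
  proof -
    have "z \<in> ?S" using poly_on_edge_in_segment[OF E_edge[OF \<omega>] z(1)] by simp
    then obtain \<omega>' where \<omega>': "\<omega>' ^ m = 1" "z \<in> ray \<omega>'" using ray_through z(2) by blast
    then have "z \<in> E \<omega>'" using ray_E by blast
    then have "E \<omega> = E \<omega>'"
      by (rule edge_eqI[OF E_edge[OF \<omega>] E_edge[OF \<omega>'(1)] z(1)])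
    then have "\<omega> = \<omega>'" by (rule E_inj[OF \<omega> \<omega>'(1)])
    then show ?thesis using \<omega>'(2) by simp
  qed
  have \<psi>0: "\<psi> 0 = v" using \<psi>\<phi>[OF N(2)] by (simp add: \<phi>)
  have limpt: "v islimpt E \<omega>" if \<omega>: "\<omega> ^ m = 1" for \<omega>
    unfolding islimpt_def
  proof (intro allI impI)
    fix T assume T: "v \<in> T" "open T"
    have "isCont \<psi> 0"
      using cont\<psi> \<rho>(1) by (simp add: \<psi>_def continuous_on_eq_continuous_at)
    moreover have "((\<lambda>r. of_real r * \<omega>) \<longlongrightarrow> of_real 0 * \<omega>) (at_right 0)"
      by (intro tendsto_intros)
    ultimately have "((\<lambda>r. \<psi> (of_real r * \<omega>)) \<longlongrightarrow> v) (at_right 0)"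
      using isCont_tendsto_compose[of 0 \<psi> "\<lambda>r. of_real r * \<omega>" "at_right 0"] by (simp add: \<psi>0)
    then have "\<forall>\<^sub>F r in at_right 0. \<psi> (of_real r * \<omega>) \<in> T"
      by (rule topological_tendstoD[OF _ T(2,1)])
    moreover have "\<forall>\<^sub>F r in at_right (0::real). r \<in> {0<..<\<rho>}"
      by (rule eventually_at_right_real[OF \<rho>(1)])
    ultimately have "\<forall>\<^sub>F r in at_right 0. \<psi> (of_real r * \<omega>) \<in> T \<and> r \<in> {0<..<\<rho>}"
      by (rule eventually_conj)
    then obtain r where r: "\<psi> (of_real r * \<omega>) \<in> T" "0 < r" "r < \<rho>"
      using eventually_happens'[of "at_right (0::real)"] by auto
    have "\<psi> (of_real r * \<omega>) \<in> ray \<omega>"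
      using r by (auto simp: ray_def)
    moreover have "\<psi> (of_real r * \<omega>) \<noteq> v"
      using P_ray[OF \<omega> r(2,3)] Pv d r(2) by auto
    ultimately show "\<exists>y\<in>E \<omega>. y \<in> T \<and> y \<noteq> v"
      using ray_E[OF \<omega>] r(1) by blast
  qed
  show ?thesis
    unfolding m_def[symmetric]
  \<comment> \<open>The derivative of \<phi> at \<open>v\<close> is \<open>k v\<close>, hence the
    first witness. The second is the distance from \<open>c1\<close> of the values of
    \<open>P\<close> on a ray at radius \<rho>.\<close>
  proof (intro exI[of _ "sgn (k v)"] exI[of _ "norm ?d * \<rho> ^ m"] exI[of _ E] conjI allI impI ballI)
    show "sgn (k v) \<noteq> 0" using k(2)[OF N(2)] by (simp add: sgn_zero_iff)
    show "0 < norm ?d * \<rho> ^ m" using d \<rho> by simp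
    show "v islimpt E \<omega>" if "\<omega> ^ m = 1" for \<omega> using limpt that .
    show "bij_betw E {\<omega>. \<omega> ^ m = 1} (edges_at P c1 c2 v)"
    proof (rule bij_betwI')
      show "E \<omega> \<in> edges_at P c1 c2 v" if "\<omega> \<in> {\<omega>. \<omega> ^ m = 1}" for \<omega>
        using that E_edge limpt by (simp add: edges_at_def closure_def)
      show "\<exists>\<omega>\<in>{\<omega>. \<omega> ^ m = 1}. e = E \<omega>" if "e \<in> edges_at P c1 c2 v" for e
      proof -
        have e: "e \<in> tree_edges P c1 c2" "v \<in> closure e" using that by (auto simp: edges_at_def)
        then obtain z where z: "z \<in> e" "z \<in> N"
          using N closure_iff_nhds_not_empty[of v e] by blast
        then have "z \<in> ?S" using poly_on_edge_in_segment[OF e(1)] by simp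
        then obtain \<omega> where \<omega>: "\<omega> ^ m = 1" "z \<in> ray \<omega>" using ray_through z(2) by blast
        then have "z \<in> E \<omega>" using ray_E by blast
        then have "e = E \<omega>" by (rule edge_eqI[OF e(1) E_edge[OF \<omega>(1)] z(1)])
        then show ?thesis using \<omega>(1) by blast
      qed
    qed (use E_inj in auto)
    show "((\<lambda>z. sgn (z - v)) \<longlongrightarrow> \<omega> / sgn (k v)) (at v within E \<omega>)" if \<omega>: "\<omega> ^ m = 1" for \<omega>
    proof -
      have "isCont k v" using k(1) N continuous_on_eq_continuous_at by blast
      then have "(k \<longlongrightarrow> k v) (at v within E \<omega>)"
        unfolding isCont_def by (rule tendsto_within_subset) simp
      then have "((\<lambda>z. \<omega> / sgn (k z)) \<longlongrightarrow> \<omega> / sgn (k v)) (at v within E \<omega>)"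
        using k(2)[OF N(2)] by (intro tendsto_intros) (auto simp: sgn_zero_iff)
      moreover have "\<forall>\<^sub>F z in at v within E \<omega>. \<omega> / sgn (k z) = sgn (z - v)"
        unfolding eventually_at_topological
      proof (intro exI[of _ N] conjI ballI impI N(1,2))
        fix z assume z: "z \<in> N" "z \<in> E \<omega>"
        from E_N[OF \<omega> z(2,1)] obtain r where r: "0 < r" "r < \<rho>" "z = \<psi> (of_real r * \<omega>)"
          by (auto simp: ray_def)
        then have "(z - v) * k z = of_real r * \<omega>"
          using \<phi>\<psi>[OF in_ball[OF \<omega>, of r]] by (simp add: \<phi>)
        then have "sgn (z - v) * sgn (k z) = sgn (of_real r) * sgn \<omega>"
          by (metis sgn_mult)
        also have "\<dots> = \<omega>"
          using r(1) unit[OF \<omega>] by (simp add: sgn_eq sgn_of_real)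
        finally show "\<omega> / sgn (k z) = sgn (z - v)"
          using k(2)[OF z(1)] by (metis nonzero_mult_div_cancel_right sgn_zero_iff)
      qed
      ultimately show ?thesis by (rule Lim_transform_eventually)
    qed
    \<comment> \<open>This concerns the whole edge and not just its part near \<open>v\<close>: by
      injectivity of \<open>P\<close> on the edge, a value this close to \<open>c1\<close> is taken
      only on the ray.\<close>
    show "z \<in> ball v \<epsilon>" if \<omega>: "\<omega> ^ m = 1" and z: "z \<in> E \<omega>" "dist (poly P z) c1 < norm ?d * \<rho> ^ m" for \<omega> z
    proof -
      obtain t where t: "0 < t" "t < 1" "poly P z = c1 + ?d * of_real t"
        using poly_on_edge_in_segment[OF E_edge[OF \<omega>] z(1)] open_segment_iff_affine[OF colors_distinct] by auto
      have "t < \<rho> ^ m"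
        using z(2) t d by (simp add: dist_norm norm_mult)
      define r where "r = root m t"
      have r: "0 < r" "r ^ m = t"
        using t(1) mpos by (auto simp: r_def)
      have "r < \<rho>"
        using \<open>t < \<rho> ^ m\<close> r \<rho> by (metis less_imp_le power_less_imp_less_base)
      have "z = \<psi> (of_real r * \<omega>)"
      proof (rule inj_onD[OF edge_inj[OF E_edge[OF \<omega>]] _ z(1)])
        show "poly P z = poly P (\<psi> (of_real r * \<omega>))"
          using P_ray[OF \<omega> r(1) \<open>r < \<rho>\<close>] t(3) r(2) by simp
        show "\<psi> (of_real r * \<omega>) \<in> E \<omega>"
          using ray_E[OF \<omega>] r(1) \<open>r < \<rho>\<close> by (auto simp: ray_def)
      qed
      then have "z \<in> N"
        using \<psi>N in_ball[OF \<omega>, of r] r(1) \<open>r < \<rho>\<close> by simp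
      then show ?thesis using N(3) by blast
    qed
  qed
qed

text \<open>The edges at \<open>v\<close> are indexed by the m-th roots of unity \<omega> and have
  directions \<omega> / u, so there are m of them and their directions differ. Nontriviality of the
  filter is recorded because it is what makes the limit defining a direction unique.\<close>

lemma
  assumes v: "v \<in> tree_vertices P c1"
  shows finite_edges_at1: "finite (edges_at P c1 c2 v)"
    and card_edges_at1: "card (edges_at P c1 c2 v) = order v (P - [:c1:])"
    and edge_direction_limit1: "e \<in> edges_at P c1 c2 v \<Longrightarrow> edge_direction v e \<noteq> 0 \<and>
      at v within e \<noteq> bot \<and> ((\<lambda>z. sgn (z - v)) \<longlongrightarrow> edge_direction v e) (at v within e)"
    and inj_edge_direction1: "inj_on (edge_direction v) (edges_at P c1 c2 v)"
proof -
  define m where "m = order v (P - [:c1:])"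
  have mpos: "m > 0"
    using order_root[of "P - [:c1:]" v] minus_const_nonzero[OF degree_pos, of c1] v
    by (simp add: m_def tree_vertices_def)
  obtain u \<delta> E where u: "u \<noteq> 0" and "\<delta> > 0"
    and bij: "bij_betw E {\<omega>. \<omega> ^ m = 1} (edges_at P c1 c2 v)"
    and E: "\<forall>\<omega>. \<omega> ^ m = 1 \<longrightarrow>
       v islimpt E \<omega> \<and> ((\<lambda>z. sgn (z - v)) \<longlongrightarrow> \<omega> / u) (at v within E \<omega>) \<and>
       (\<forall>z \<in> E \<omega>. dist (poly P z) c1 < \<delta> \<longrightarrow> z \<in> ball v 1)"
    using vertex_star[OF v zero_less_one, folded m_def] by (elim exE conjE) (rule that)
  have limpt: "v islimpt E \<omega>"
    and lim: "((\<lambda>z. sgn (z - v)) \<longlongrightarrow> \<omega> / u) (at v within E \<omega>)" if "\<omega> ^ m = 1" for \<omega>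
    using E that by simp_all
  have "finite {\<omega> :: complex. \<omega> ^ m = 1}" "card {\<omega> :: complex. \<omega> ^ m = 1} = m"
    using mpos finite_roots_unity card_roots_unity_eq by auto
  then show "finite (edges_at P c1 c2 v)" "card (edges_at P c1 c2 v) = order v (P - [:c1:])"
    using bij_betw_finite[OF bij] bij_betw_same_card[OF bij] by (auto simp: m_def)
  have dir: "edge_direction v (E \<omega>) = \<omega> / u" if "\<omega> ^ m = 1" for \<omega>
    unfolding edge_direction_def
    by (rule tendsto_Lim[OF _ lim[OF that]]) (simp add: trivial_limit_within limpt[OF that])
  have surj: "\<exists>\<omega>. \<omega> ^ m = 1 \<and> e = E \<omega>" if "e \<in> edges_at P c1 c2 v" for e
    using that bij_betw_imp_surj_on[OF bij] by auto
  show "edge_direction v e \<noteq> 0 \<and>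
      at v within e \<noteq> bot \<and> ((\<lambda>z. sgn (z - v)) \<longlongrightarrow> edge_direction v e) (at v within e)"
    if "e \<in> edges_at P c1 c2 v"
  proof -
    from surj[OF that] obtain \<omega> where \<omega>: "\<omega> ^ m = 1" "e = E \<omega>"
      by (elim exE conjE)
    moreover have "\<omega> \<noteq> 0" using \<omega>(1) mpos by (metis power_eq_0_iff zero_neq_one power_0_left less_irrefl)
    moreover have "at v within E \<omega> \<noteq> bot"
      using limpt[OF \<omega>(1)] trivial_limit_within by blast
    ultimately show ?thesis using u lim dir by simp
  qed
  show "inj_on (edge_direction v) (edges_at P c1 c2 v)"
  proof (rule inj_onI)
    fix e e' assume "e \<in> edges_at P c1 c2 v" "e' \<in> edges_at P c1 c2 v"
    from surj[OF this(1)] surj[OF this(2)]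
    obtain \<omega> \<omega>' where "\<omega> ^ m = 1" "e = E \<omega>" "\<omega>' ^ m = 1" "e' = E \<omega>'"
      by (elim exE conjE)
    moreover assume "edge_direction v e = edge_direction v e'"
    ultimately show "e = e'" using dir u by simp
  qed
qed

text \<open>Near a second end over \<open>c1\<close> the edge would have points with values close to
  \<open>c1\<close>. By the last clause of \<open>vertex_star\<close> all such points lie close to
  \<open>v\<close>, and balls of half the distance about the two vertices are disjoint.\<close>

lemma endpoint_unique1:
  assumes v: "v \<in> tree_vertices P c1" and v': "v' \<in> tree_vertices P c1"
    and e: "e \<in> edges_at P c1 c2 v" "e \<in> edges_at P c1 c2 v'"
  shows "v = v'"
proof (rule ccontr)
  assume "v \<noteq> v'"
  define \<epsilon> where "\<epsilon> = dist v v' / 2"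
  have "\<epsilon> > 0" using \<open>v \<noteq> v'\<close> by (simp add: \<epsilon>_def)
  obtain u \<delta> E where "u \<noteq> 0" and \<delta>: "\<delta> > 0"
    and bij: "bij_betw E {\<omega>. \<omega> ^ order v (P - [:c1:]) = 1} (edges_at P c1 c2 v)"
    and E: "\<forall>\<omega>. \<omega> ^ order v (P - [:c1:]) = 1 \<longrightarrow>
       v islimpt E \<omega> \<and> ((\<lambda>z. sgn (z - v)) \<longlongrightarrow> \<omega> / u) (at v within E \<omega>) \<and>
       (\<forall>z \<in> E \<omega>. dist (poly P z) c1 < \<delta> \<longrightarrow> z \<in> ball v \<epsilon>)"
    using vertex_star[OF v \<open>\<epsilon> > 0\<close>] by (elim exE conjE) (rule that)
  obtain \<omega> where \<omega>: "\<omega> ^ order v (P - [:c1:]) = 1" "e = E \<omega>"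
    using e(1) bij_betw_imp_surj_on[OF bij] by auto
  let ?U = "ball v' \<epsilon> \<inter> poly P -` ball c1 \<delta>"
  have "open ?U"
    by (intro open_Int open_ball open_vimage continuous_intros)
  moreover have "v' \<in> ?U"
    using \<open>\<epsilon> > 0\<close> \<delta> v' by (simp add: tree_vertices_def)
  moreover have "v' \<in> closure e" using e(2) by (simp add: edges_at_def)
  ultimately obtain z where z: "z \<in> e" "z \<in> ?U"
    using closure_iff_nhds_not_empty[of v' e] by blast
  then have "dist (poly P z) c1 < \<delta>" by (simp add: dist_commute)
  then have "z \<in> ball v \<epsilon>" using E \<omega> z(1) by simp
  then have "dist v v' < 2 * \<epsilon>"
    using z(2) dist_triangle2[of v v' z] by simp
  then show False by (simp add: \<epsilon>_def)
qed

lemma finite_edges_at: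
  assumes "v \<in> tree_vertices P c1 \<union> tree_vertices P c2"
  shows "finite (edges_at P c1 c2 v)"
  using assms finite_edges_at1 shabat_tree.finite_edges_at1[OF swap] by (auto simp: edges_at_swap)

lemma card_edges_at2:
  assumes "v \<in> tree_vertices P c2"
  shows "card (edges_at P c1 c2 v) = order v (P - [:c2:])"
  using shabat_tree.card_edges_at1[OF swap assms] by (simp add: edges_at_swap)

lemma edge_direction_limit:
  assumes "v \<in> tree_vertices P c1 \<union> tree_vertices P c2" "e \<in> edges_at P c1 c2 v"
  shows "edge_direction v e \<noteq> 0" "at v within e \<noteq> bot"
    "((\<lambda>z. sgn (z - v)) \<longlongrightarrow> edge_direction v e) (at v within e)"
  using assms edge_direction_limit1[of v e] shabat_tree.edge_direction_limit1[OF swap, of v e]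
  by (auto simp: edges_at_swap)

lemma inj_edge_direction:
  assumes "v \<in> tree_vertices P c1 \<union> tree_vertices P c2"
  shows "inj_on (edge_direction v) (edges_at P c1 c2 v)"
  using assms inj_edge_direction1[of v] shabat_tree.inj_edge_direction1[OF swap, of v]
  by (auto simp: edges_at_swap)

lemma edge_endpoint1: "e \<in> tree_edges P c1 c2 \<Longrightarrow> \<exists>!v. v \<in> tree_vertices P c1 \<and> e \<in> edges_at P c1 c2 v"
  using edge_exists_endpoint endpoint_unique1 by metis

lemma edge_endpoint2: "e \<in> tree_edges P c1 c2 \<Longrightarrow> \<exists>!v. v \<in> tree_vertices P c2 \<and> e \<in> edges_at P c1 c2 v"
  using shabat_tree.edge_endpoint1[OF swap, of e] by (simp add: tree_edges_swap edges_at_swap)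

lemma edges_atD: "e \<in> edges_at P c1 c2 v \<Longrightarrow> e \<in> tree_edges P c1 c2"
  by (simp add: edges_at_def)

lemma vertices_disjoint: "tree_vertices P c1 \<inter> tree_vertices P c2 = {}"
  using colors_distinct by (auto simp: tree_vertices_def)

lemma edges_at_disjoint1:
  assumes "v \<in> tree_vertices P c1" "v' \<in> tree_vertices P c1" "v \<noteq> v'"
  shows "edges_at P c1 c2 v \<inter> edges_at P c1 c2 v' = {}"
  using endpoint_unique1[OF assms(1,2)] assms(3) by blast

lemma tree_edges_eq_Union: "tree_edges P c1 c2 = (\<Union>v\<in>tree_vertices P c1. edges_at P c1 c2 v)"
  using edge_endpoint1 edges_atD by blast

lemma finite_tree_edges: "finite (tree_edges P c1 c2)"
  unfolding tree_edges_eq_Union using finite_vertices finite_edges_at1 by blast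

text \<open>Each edge is counted once, at its unique end over \<open>c1\<close>; the orders in that
  fibre add up to the degree.\<close>

lemma card_tree_edges: "card (tree_edges P c1 c2) = degree P"
proof -
  have "card (tree_edges P c1 c2) = (\<Sum>v\<in>tree_vertices P c1. card (edges_at P c1 c2 v))"
    unfolding tree_edges_eq_Union
    by (intro card_UN_disjoint finite_vertices) (use finite_edges_at1 edges_at_disjoint1 in blast)+
  also have "\<dots> = (\<Sum>v | poly (P - [:c1:]) v = 0. order v (P - [:c1:]))"
    by (intro sum.cong) (auto simp: tree_vertices_def card_edges_at1)
  also have "\<dots> = degree P"
    using sum_order_eq_degree[OF minus_const_nonzero[OF degree_pos, of c1]] by simp
  finally show ?thesis .
qed

end

section \<open>Connectedness of the tree\<close>

text \<open>If the segment met \<open>c\<close>, then \<open>c\<close> itself would be the closest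
  point, being in \<open>D\<close> and on the way. An interior point is never closest to a point
  outside. The lemma keeps a straight-line homotopy away from the critical values.\<close>

lemma segment_to_closest_point_avoids_interior:
  fixes D :: "'a::euclidean_space set"
  assumes D: "closed D" "convex D" and c: "c \<in> interior D" and w: "w \<noteq> c"
    and u: "u \<in> closed_segment w (closest_point D w)"
  shows "u \<noteq> c"
proof (cases "w \<in> D")
  case True
  then show ?thesis using u w by (simp add: closest_point_self)
next
  case False
  let ?a = "closest_point D w"
  have "u \<noteq> c" if eq: "?a = c"
  proof -
    obtain \<eta> where \<eta>: "\<eta> > 0" "cball c \<eta> \<subseteq> D"
      using c by (metis mem_interior_cball)
    \<comment> \<open>Moving from \<open>c\<close> by \<eta> towards \<open>w\<close> stays in
      \<open>D\<close>, against the obtuse angle that \<open>D\<close> makes at a closest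
      point.\<close>
    define x where "x = c + (\<eta> / norm (w - c)) *\<^sub>R (w - c)"
    have "x \<in> D"
      using \<eta> w by (intro subsetD[OF \<eta>(2)]) (simp add: x_def dist_norm)
    then have "inner (w - c) (x - c) \<le> 0"
      using closest_point_dot[OF D(2,1), of x w] eq by simp
    moreover have "inner (w - c) (x - c) > 0"
      using \<eta>(1) w by (simp add: x_def)
    ultimately show ?thesis by simp
  qed
  moreover have "?a = c" if "u = c"
  proof -
    have "c \<in> D" using c interior_subset by blast
    then have "dist w ?a \<le> dist w c" by (rule closest_point_le[OF D(1)])
    moreover have "dist w ?a = dist w u + dist u ?a"
      using u by (simp add: between_mem_segment[symmetric] between)
    ultimately show ?thesis using that by simp
  qed
  ultimately show ?thesis by blast
qed

context shabat_tree
begin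

text \<open>That the critical values are interior serves twice: paths pushed into \<open>D\<close>
  do not run into them, and the vertices are limits of the rest of the preimage, so adding them
  keeps it connected.\<close>

lemma connected_vimage_convex:
  assumes D: "closed D" "convex D" and c: "c1 \<in> interior D" "c2 \<in> interior D"
  shows "connected (poly P -` D)"
proof -
  let ?W = "- {c1, c2}"
  let ?C = "poly P -` ?W"
  let ?K = "poly P -` (D - {c1, c2})"
  have cov: "covering_space ?C (poly P) ?W"
    using noncritical by (intro poly_covering_space[OF degree_pos]) auto
  have "- ?C = tree_vertices P c1 \<union> tree_vertices P c2"
    by (auto simp: tree_vertices_def)
  then have fin: "finite (- ?C)"
    using finite_vertices by simp
  have "path_connected ?C"
    using path_connected_complement_countable[of "- ?C"] fin by (simp add: countable_finite)
  have Dne: "D \<noteq> {}" using c interior_subset by blast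
  \<comment> \<open>A path in the cover is pushed into \<open>D\<close> by moving its image along segments to the closest points
    of \<open>D\<close>. This homotopy avoids both critical values, hence lifts.\<close>
  have "path_connected ?K"
    unfolding path_connected_def
  proof (intro ballI)
    fix x y assume x: "x \<in> ?K" and y: "y \<in> ?K"
    then obtain \<gamma> where \<gamma>: "path \<gamma>" "path_image \<gamma> \<subseteq> ?C" "pathstart \<gamma> = x" "pathfinish \<gamma> = y"
      using \<open>path_connected ?C\<close> unfolding path_connected_def by (metis ComplI DiffE vimageD vimageI2)
    define g where "g = poly P \<circ> \<gamma>"
    define h where "h = closest_point D \<circ> g"
    have g: "path g" "path_image g \<subseteq> ?W"
      unfolding g_def using \<gamma>(1,2)
      by (auto intro!: path_continuous_image continuous_intros simp: path_image_compose)
    have h: "path h"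
      unfolding h_def using D Dne g(1) by (intro path_continuous_image continuous_on_closest_point)
    have ends: "pathstart h = pathstart g" "pathfinish h = pathfinish g"
      using x y \<gamma>(3,4) by (simp_all add: h_def g_def pathstart_compose pathfinish_compose closest_point_self)
    have seg: "closed_segment (g t) (h t) \<subseteq> ?W" if "t \<in> {0..1}" for t
    proof -
      have "g t \<in> ?W" using g(2) that unfolding path_image_def by blast
      then show ?thesis
        using segment_to_closest_point_avoids_interior[OF D c(1), of "g t"]
          segment_to_closest_point_avoids_interior[OF D c(2), of "g t"] by (auto simp: h_def)
    qed
    have hom: "homotopic_paths ?W g h"
      using homotopic_paths_linear[OF g(1) h ends] seg by blast
    have hW: "path_image h \<subseteq> ?W"
      using seg by (force simp: path_image_def)
    have "pathstart h = poly P x"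
      using ends \<gamma>(3) by (simp add: g_def pathstart_compose)
    then obtain k where k: "path k" "path_image k \<subseteq> ?C" "pathstart k = x"
      "\<And>t. t \<in> {0..1} \<Longrightarrow> poly P (k t) = h t"
      using covering_space_lift_path_strong[OF cov _ h hW, of x] x by auto
    have "homotopic_paths ?C \<gamma> k"
      using covering_space_lift_homotopic_paths[OF cov g h hW hom \<gamma>(1,2) _ k(1,2) k(4)] \<gamma>(3) k(3)
      by (simp add: g_def)
    then have "pathfinish k = y"
      using homotopic_paths_imp_pathfinish \<gamma>(4) by metis
    moreover have "path_image k \<subseteq> ?K"
    proof
      fix z assume z: "z \<in> path_image k"
      then obtain t where t: "t \<in> {0..1}" "z = k t" by (auto simp: path_image_def)
      have "h t \<in> D" using closest_point_in_set[OF D(1) Dne] by (simp add: h_def)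
      then show "z \<in> ?K" using t k(4)[OF t(1)] k(2) z by auto
    qed
    ultimately show "\<exists>g. path g \<and> path_image g \<subseteq> ?K \<and> pathstart g = x \<and> pathfinish g = y"
      using k by blast
  qed
  then have "connected ?K" by (rule path_connected_imp_connected)
  moreover have "?K \<subseteq> poly P -` D" by auto
  moreover have "poly P -` D \<subseteq> closure ?K"
  proof
    fix z assume z: "z \<in> poly P -` D"
    show "z \<in> closure ?K"
    proof (cases "z \<in> ?C")
      case True
      then have "z \<in> ?K" using z by auto
      then show ?thesis by (rule subsetD[OF closure_subset])
    next
      case False
      \<comment> \<open>A vertex lies in this open set, and deleting finitely many points leaves a
        set that still accumulates at the vertex.\<close>
      have "open (poly P -` interior D)"
        by (intro open_vimage open_interior continuous_intros)
      then have "poly P -` interior D \<inter> closure ?C \<subseteq> closure (poly P -` interior D \<inter> ?C)"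
        by (rule open_Int_closure_subset)
      also have "\<dots> \<subseteq> closure ?K"
        by (rule closure_mono) (use interior_subset in auto)
      finally have "poly P -` interior D \<inter> closure ?C \<subseteq> closure ?K" .
      moreover have "closure ?C = UNIV"
        using closure_complement[of "- ?C"] empty_interior_finite[OF fin] by simp
      ultimately have "poly P -` interior D \<subseteq> closure ?K" by simp
      then show ?thesis
        using False c by auto
    qed
  qed
  ultimately show ?thesis
    by (rule connected_intermediate_closure)
qed

text \<open>The segment has empty interior, so it is thickened by discs of radius 1/(n+1). The
  preimages of the thickenings are nested, compact and connected, and such sets have connected
  intersection.\<close>

lemma connected_tree: "connected (poly P -` closed_segment c1 c2)"
proof -
  let ?S = "closed_segment c1 c2"
  define D where "D n = (\<Union>x\<in>?S. \<Union>y\<in>cball 0 (inverse (real (Suc n))). {x + y})" for n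
  have convD: "convex (D n)" for n
    unfolding D_def by (intro convex_sums) auto
  have compD: "compact (D n)" for n
  proof -
    have "D n = {x + y |x y. x \<in> ?S \<and> y \<in> cball 0 (inverse (real (Suc n)))}"
      unfolding D_def by blast
    then show ?thesis
      by (simp only:) (intro compact_sums compact_segment compact_cball)
  qed
  have int: "c \<in> interior (D n)" if "c \<in> ?S" for c n
    unfolding mem_interior
  proof (intro exI conjI)
    show "ball c (inverse (real (Suc n))) \<subseteq> D n"
    proof
      fix z assume "z \<in> ball c (inverse (real (Suc n)))"
      then have "z - c \<in> cball 0 (inverse (real (Suc n)))"
        by (simp add: dist_norm norm_minus_commute)
      then show "z \<in> D n"
        unfolding D_def using that by (intro UN_I[of c] UN_I[of "z - c"]) auto
    qed
  qed simp
  have "connected (\<Inter> (range (\<lambda>n. poly P -` D n)))"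
  proof (rule connected_nest)
    show "compact (poly P -` D n)" for n
      by (rule compact_poly_vimage[OF degree_pos compD])
    show "connected (poly P -` D n)" for n
      using connected_vimage_convex[OF compact_imp_closed[OF compD] convD] int by auto
    show "poly P -` D n \<subseteq> poly P -` D m" if "m \<le> n" for m n
    proof -
      have "inverse (real (Suc n)) \<le> inverse (real (Suc m))"
        using that by (intro le_imp_inverse_le) auto
      then have "cball (0::complex) (inverse (real (Suc n))) \<subseteq> cball 0 (inverse (real (Suc m)))"
        by (rule subset_cball)
      then show ?thesis unfolding D_def by blast
    qed
  qed
  moreover have "(\<Inter>n. D n) = ?S"
  proof (intro equalityI subsetI)
    fix w assume w: "w \<in> (\<Inter>n. D n)"
    have "infdist w ?S \<le> inverse (real (Suc n))" for n
    proof -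
      obtain x y where "x \<in> ?S" "y \<in> cball 0 (inverse (real (Suc n)))" "w = x + y"
        using w unfolding D_def by blast
      then show ?thesis
        using infdist_le2[of x ?S w "inverse (real (Suc n))"] by (simp add: dist_norm)
    qed
    then have "infdist w ?S \<le> 0"
      using LIMSEQ_le_const[OF LIMSEQ_inverse_real_of_nat] by blast
    then have "infdist w ?S = 0" using infdist_nonneg[of w ?S] by simp
    then show "w \<in> ?S"
      using in_closed_iff_infdist_zero[of ?S w] by auto
  next
    fix w assume "w \<in> ?S"
    then show "w \<in> (\<Inter>n. D n)" using int interior_subset by blast
  qed
  ultimately show ?thesis
    by (simp flip: vimage_INT)
qed

text \<open>This is connectedness in combinatorial form. If vertices were left over,
  \<open>X\<close> with the closed edges at it and the remaining vertices with theirs would separate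
  the tree; both sets are closed because there are finitely many edges.\<close>

lemma vertex_set_closed_under_adjacency:
  assumes X: "X \<subseteq> tree_vertices P c1 \<union> tree_vertices P c2" "X \<noteq> {}"
    and adj: "\<And>v v' e. \<lbrakk>v \<in> X; v' \<in> tree_vertices P c1 \<union> tree_vertices P c2;
               e \<in> edges_at P c1 c2 v; e \<in> edges_at P c1 c2 v'\<rbrakk> \<Longrightarrow> v' \<in> X"
  shows "X = tree_vertices P c1 \<union> tree_vertices P c2"
proof -
  let ?V = "tree_vertices P c1 \<union> tree_vertices P c2"
  let ?T = "tree_edges P c1 c2"
  let ?K = "poly P -` closed_segment c1 c2"
  define A where "A = X \<union> \<Union> {closure e |e. \<exists>v\<in>X. e \<in> edges_at P c1 c2 v}"
  define B where "B = (?V - X) \<union> \<Union> {closure e |e. \<exists>v\<in>?V - X. e \<in> edges_at P c1 c2 v}"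
  have finV: "finite ?V" using finite_vertices by simp
  have fin_edges: "finite {closure e |e. \<exists>v\<in>Y. e \<in> edges_at P c1 c2 v}" for Y
    by (rule finite_subset[of _ "closure ` ?T"]) (auto simp: finite_tree_edges dest: edges_atD)
  have clos: "closed (\<Union> {closure e |e. \<exists>v\<in>Y. e \<in> edges_at P c1 c2 v})" for Y
    by (rule closed_Union[OF fin_edges]) auto
  have "finite X" "finite (?V - X)" using finV X(1) finite_subset by blast+
  have "closed A"
    unfolding A_def by (rule closed_Un[OF finite_imp_closed[OF \<open>finite X\<close>] clos])
  have "closed B"
    unfolding B_def by (rule closed_Un[OF finite_imp_closed[OF \<open>finite (?V - X)\<close>] clos])
  have "?K \<subseteq> A \<union> B"
  proof
    fix z assume "z \<in> ?K"
    then consider "z \<in> ?V" | "poly P z \<in> open_segment c1 c2"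
      by (auto simp: tree_vertices_def open_segment_def)
    then show "z \<in> A \<union> B"
    proof cases
      case 2
      then obtain e where e: "e \<in> ?T" "z \<in> e" by (rule edge_through)
      then obtain v where "v \<in> ?V" "e \<in> edges_at P c1 c2 v" using edge_endpoint1 by blast
      then show ?thesis using closure_subset e(2) unfolding A_def B_def by blast
    qed (auto simp: A_def B_def)
  qed
  have ends: "v' \<in> X" if "v \<in> X" "e \<in> edges_at P c1 c2 v" "v' \<in> ?V" "v' \<in> closure e" for v v' e
    using that adj[of v v' e] by (simp add: edges_at_def)
  have mem: "z \<in> e \<or> z \<in> ?V" if "e \<in> edges_at P c1 c2 v" "z \<in> closure e" for z e v
    using closure_edge_cases[OF edges_atD[OF that(1)] that(2)] by (auto simp: tree_vertices_def)
  have notV: "z \<notin> ?V" if "e \<in> edges_at P c1 c2 v" "z \<in> e" for z e v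
    using poly_on_edge_in_segment[OF edges_atD[OF that(1)] that(2)]
    by (auto simp: tree_vertices_def open_segment_def)
  have "A \<inter> B \<inter> ?K = {}"
  proof (rule ccontr)
    assume "A \<inter> B \<inter> ?K \<noteq> {}"
    then obtain z where zA: "z \<in> A" and zB: "z \<in> B" by blast
    have A': "z \<in> X \<or> (\<exists>v\<in>X. \<exists>e. e \<in> edges_at P c1 c2 v \<and> z \<in> e)"
    proof (cases "z \<in> X")
      case False
      then obtain v e where "v \<in> X" "e \<in> edges_at P c1 c2 v" "z \<in> closure e"
        using zA by (auto simp: A_def)
      then show ?thesis using mem ends by blast
    qed simp
    have B': "z \<in> ?V - X \<or> (\<exists>v\<in>?V - X. \<exists>e. e \<in> edges_at P c1 c2 v \<and> z \<in> e)"
    proof (cases "z \<in> ?V - X")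
      case False
      then obtain v e where ve: "v \<in> ?V - X" "e \<in> edges_at P c1 c2 v" "z \<in> closure e"
        using zB by (auto simp: B_def)
      moreover have "z \<notin> ?V"
      proof
        assume "z \<in> ?V"
        then have "z \<in> X" using False by blast
        moreover have "e \<in> edges_at P c1 c2 z" using ve by (simp add: edges_at_def)
        ultimately show False using adj[of z v e] ve by blast
      qed
      ultimately show ?thesis using mem by blast
    qed simp
    show False
    proof (cases "z \<in> ?V")
      case True
      then show False using A' B' notV by blast
    next
      case False
      then obtain v e v' e' where v: "v \<in> X" "e \<in> edges_at P c1 c2 v" "z \<in> e"
        and v': "v' \<in> ?V - X" "e' \<in> edges_at P c1 c2 v'" "z \<in> e'"
        using A' B' X(1) by blast
      then have "e = e'" using edge_eqI edges_atD by blast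
      then show False using adj[of v v' e] v v' by blast
    qed
  qed
  then have "A \<inter> ?K = {} \<or> B \<inter> ?K = {}"
    using connected_tree \<open>closed A\<close> \<open>closed B\<close> \<open>?K \<subseteq> A \<union> B\<close>
    unfolding connected_closed by blast
  moreover have "?V \<subseteq> ?K" by (auto simp: tree_vertices_def)
  ultimately show ?thesis
    using X unfolding A_def B_def by blast
qed

end

subsection \<open>Isomorphisms and mirror images\<close>

text \<open>Only edges appear, with the two equivalence relations of sharing a black end
  (\<open>b\<close>) or a white end (\<open>w\<close>); connectedness says that a nonempty set
  closed under both is everything. No cyclic order is mentioned, so the lemma applies to a \<tau>
  that reverses orientation. The bound 7 is the size of the largest symmetric component met in the
  case analysis.\<close>

lemma fixed_star_of_automorphism:
  fixes E :: "'e set" and b :: "'e \<Rightarrow> 'b" and w :: "'e \<Rightarrow> 'w" and \<tau> :: "'e \<Rightarrow> 'e"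
  defines "B \<equiv> \<lambda>e. {e' \<in> E. b e' = b e}" and "W \<equiv> \<lambda>e. {e' \<in> E. w e' = w e}"
  assumes card_E: "card E > 7" and \<tau>: "bij_betw \<tau> E E"
    and \<tau>b: "\<And>e e'. \<lbrakk>e \<in> E; e' \<in> E\<rbrakk> \<Longrightarrow> b (\<tau> e) = b (\<tau> e') \<longleftrightarrow> b e = b e'"
    and \<tau>w: "\<And>e e'. \<lbrakk>e \<in> E; e' \<in> E\<rbrakk> \<Longrightarrow> w (\<tau> e) = w (\<tau> e') \<longleftrightarrow> w e = w e'"
    and card_B: "\<And>e. e \<in> E \<Longrightarrow> card (B e) \<in> {1, 3}"
    and card_B3: "\<And>e e' e''. \<lbrakk>e \<in> E; e' \<in> E; e'' \<in> E; card (B e) = 3; card (B e') = 3; card (B e'') = 3\<rbrakk>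
        \<Longrightarrow> b e = b e' \<or> b e = b e'' \<or> b e' = b e''"
    and card_W: "\<And>e. e \<in> E \<Longrightarrow> card (W e) \<in> {1, 2}"
    and card_W1: "\<exists>!e. e \<in> E \<and> card (W e) = 1"
    and connected: "\<And>F. \<lbrakk>F \<subseteq> E; F \<noteq> {}; \<And>e. e \<in> F \<Longrightarrow> B e \<subseteq> F; \<And>e. e \<in> F \<Longrightarrow> W e \<subseteq> F\<rbrakk> \<Longrightarrow> F = E"
  obtains e where "e \<in> E" "card (B e) = 3" "\<And>f. f \<in> B e \<Longrightarrow> \<tau> f = f"
proof -
  have \<tau>E: "\<tau> e \<in> E" if "e \<in> E" for e using \<tau> that by (auto simp: bij_betw_def)
  have \<tau>inj: "e = e'" if "\<tau> e = \<tau> e'" "e \<in> E" "e' \<in> E" for e e'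
    using \<tau> that by (auto simp: bij_betw_def inj_on_def)
  have \<tau>surj: "\<exists>e'\<in>E. e = \<tau> e'" if "e \<in> E" for e using \<tau> that by (auto simp: bij_betw_def)
  have self: "e \<in> B e" "e \<in> W e" if "e \<in> E" for e using that by (auto simp: B_def W_def)
  have sub: "B e \<subseteq> E" "W e \<subseteq> E" for e by (auto simp: B_def W_def)
  have B_eq: "B e' = B e" and b_eq: "b e' = b e" if "e' \<in> B e" for e e' using that by (auto simp: B_def)
  have W_eq: "W e' = W e" if "e' \<in> W e" for e e' using that by (auto simp: W_def)
  have \<tau>B: "\<tau> ` B e = B (\<tau> e)" if "e \<in> E" for e
  proof
    show "\<tau> ` B e \<subseteq> B (\<tau> e)" using that \<tau>E \<tau>b by (auto simp: B_def)
    show "B (\<tau> e) \<subseteq> \<tau> ` B e"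
    proof
      fix f assume f: "f \<in> B (\<tau> e)"
      then obtain g where g: "g \<in> E" "f = \<tau> g" using \<tau>surj by (auto simp: B_def)
      then have "g \<in> B e" using f \<tau>b[OF g(1) that] by (simp add: B_def)
      then show "f \<in> \<tau> ` B e" using g(2) by simp
    qed
  qed
  have \<tau>W: "\<tau> ` W e = W (\<tau> e)" if "e \<in> E" for e
  proof
    show "\<tau> ` W e \<subseteq> W (\<tau> e)" using that \<tau>E \<tau>w by (auto simp: W_def)
    show "W (\<tau> e) \<subseteq> \<tau> ` W e"
    proof
      fix f assume f: "f \<in> W (\<tau> e)"
      then obtain g where g: "g \<in> E" "f = \<tau> g" using \<tau>surj by (auto simp: W_def)
      then have "g \<in> W e" using f \<tau>w[OF g(1) that] by (simp add: W_def)
      then show "f \<in> \<tau> ` W e" using g(2) by simp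
    qed
  qed
  have \<tau>inj_on: "inj_on \<tau> A" if "A \<subseteq> E" for A
    using \<tau> that by (auto simp: bij_betw_def intro: inj_on_subset)
  have card_\<tau>B: "card (B (\<tau> e)) = card (B e)" if "e \<in> E" for e
    using card_image[OF \<tau>inj_on[OF sub(1)]] \<tau>B[OF that] by metis
  have card_\<tau>W: "card (W (\<tau> e)) = card (W e)" if "e \<in> E" for e
    using card_image[OF \<tau>inj_on[OF sub(2)]] \<tau>W[OF that] by metis
  \<comment> \<open>Lists bound the number of edges by their length without any proof that the
    entries are distinct.\<close>
  have small: False if "set L \<subseteq> E" "L \<noteq> []" "length L \<le> 7" "\<forall>e\<in>set L. B e \<subseteq> set L \<and> W e \<subseteq> set L" for L
  proof -
    have "set L = E" using that(1,2,4) by (intro connected) auto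
    then have "card E \<le> 7" using card_length[of L] that(3) by simp
    then show False using card_E by simp
  qed
  obtain e0 where e0: "e0 \<in> E" "card (W e0) = 1" and e0_unique: "\<And>e. \<lbrakk>e \<in> E; card (W e) = 1\<rbrakk> \<Longrightarrow> e = e0"
    using card_W1 by blast
  have \<tau>e0: "\<tau> e0 = e0" using e0_unique[of "\<tau> e0"] \<tau>E card_\<tau>W e0 by simp
  have We0: "W e0 = {e0}" using e0(2) self(2)[OF e0(1)] by (metis card_1_singletonE singletonD)
  have B1: "B e = {e}" if "e \<in> E" "card (B e) \<noteq> 3" for e
    using that card_B[of e] self(1)[of e] by (metis card_1_singletonE singletonD insertE empty_iff)
  have W2: "\<exists>f. f \<in> E \<and> f \<noteq> e \<and> W e = {e, f}" if "e \<in> E" "e \<noteq> e0" for e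
  proof -
    have "card (W e) = 2" using card_W[OF that(1)] e0_unique[OF that(1)] that(2) by auto
    then obtain x y where xy: "W e = {x, y}" "x \<noteq> y" by (meson card_2_iff)
    then show ?thesis using self(2)[OF that(1)] sub(2)[of e] by auto
  qed
  \<comment> \<open>If the black end of the leaf edge \<open>e0\<close> had degree 1, this edge
    alone would be a component.\<close>
  have "card (B e0) = 3"
  proof (rule ccontr)
    assume "card (B e0) \<noteq> 3"
    then have "B e0 = {e0}" using B1 e0 by blast
    then show False using small[of "[e0]"] e0(1) We0 by simp
  qed
  then have "card (B e0 - {e0}) = 2" using self(1)[OF e0(1)] by simp
  then obtain e1 e2 where e12: "B e0 - {e0} = {e1, e2}" "e1 \<noteq> e2" by (meson card_2_iff)
  then have Be0: "B e0 = {e0, e1, e2}" using self(1)[OF e0(1)] by blast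
  have ne: "e1 \<noteq> e0" "e2 \<noteq> e0" using e12 by blast+
  have inE: "e1 \<in> E" "e2 \<in> E" using sub(1)[of e0] Be0 by blast+
  have Be12: "B e1 = {e0, e1, e2}" "B e2 = {e0, e1, e2}" using B_eq[of e1 e0] B_eq[of e2 e0] Be0 by auto
  have im: "\<tau> ` {e0, e1, e2} = {e0, e1, e2}" using \<tau>B[OF e0(1)] \<tau>e0 Be0 by simp
  have ne': "\<tau> e1 \<noteq> e0" "\<tau> e2 \<noteq> e0" "\<tau> e1 \<noteq> \<tau> e2"
    using \<tau>inj[of e1 e0] \<tau>inj[of e2 e0] \<tau>inj[of e1 e2] \<tau>e0 ne inE e0(1) e12(2) by auto
  \<comment> \<open>If \<open>\<tau>\<close> swapped \<open>e1\<close> and \<open>e2\<close>, the component of \<open>e0\<close> would be symmetric and have at most 7 edges.\<close>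
  have "\<tau> e1 = e1"
  proof (rule ccontr)
    assume "\<tau> e1 \<noteq> e1"
    moreover have "\<tau> e1 \<in> {e0, e1, e2}" "\<tau> e2 \<in> {e0, e1, e2}" using im by blast+
    ultimately have sw: "\<tau> e1 = e2" "\<tau> e2 = e1" using ne' by auto
    \<comment> \<open>\<open>f1\<close> continues \<open>e1\<close> beyond its white end, and its
      image \<open>f2\<close> continues \<open>e2\<close>. The two branches are followed until they
      close up.\<close>
    obtain f1 where f1: "f1 \<in> E" "f1 \<noteq> e1" "W e1 = {e1, f1}" using W2[OF inE(1) ne(1)] by blast
    have Wf1: "W f1 = {e1, f1}" using W_eq[of f1 e1] f1(3) by simp
    define f2 where "f2 = \<tau> f1"
    have f2: "f2 \<in> E" using \<tau>E f1(1) by (simp add: f2_def)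
    have We2: "W e2 = {e2, f2}" using \<tau>W[OF inE(1)] f1(3) sw by (simp add: f2_def)
    then have Wf2: "W f2 = {e2, f2}" using W_eq[of f2 e2] by simp
    have f1e2: "f1 \<noteq> e2"
    proof
      assume "f1 = e2"
      then have "W e2 = {e1, e2}" using Wf1 by simp
      then show False
        using small[of "[e0, e1, e2]"] e0(1) inE We0 f1(3) Be0 Be12 \<open>f1 = e2\<close> by auto
    qed
    have f1e0: "f1 \<noteq> e0" using Wf1 We0 ne by auto
    have f12: "f1 \<noteq> f2"
    proof
      assume "f1 = f2"
      then show False using Wf1 Wf2 e12(2) f1e2 by auto
    qed
    have f2e: "f2 \<noteq> e0" "f2 \<noteq> e1" "f2 \<noteq> e2"
      using Wf2 We0 ne f1 We2 e12(2) \<tau>inj[of f1 e1] inE sw f12 f1e2 unfolding f2_def by auto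
    have not_in: "b f1 \<noteq> b e0" "b f2 \<noteq> b e0"
      using f1(1,2) f1e0 f1e2 f2 f2e Be0 by (auto simp: B_def)
    have \<tau>Bf: "card (B f2) = card (B f1)" "\<tau> ` B f1 = B f2"
      using card_\<tau>B[OF f1(1)] \<tau>B[OF f1(1)] by (simp_all add: f2_def)
    show False
    proof (cases "card (B f1) = 3")
      case False
      then have "B f1 = {f1}" "B f2 = {f2}" using B1 f1(1) f2 \<tau>Bf(1) by auto
      then show False
        using small[of "[e0, e1, e2, f1, f2]"] e0(1) inE f1(1) f2 We0 f1(3) Wf1 We2 Wf2 Be0 Be12 by auto
    next
      case True
      \<comment> \<open>Among three edges with black ends of degree 3 two share their end. The end
        of \<open>e0\<close> differs from the other two, so \<open>f1\<close> and \<open>f2\<close>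
        meet.\<close>
      then have "b f1 = b f2"
        using card_B3[OF e0(1) f1(1) f2 \<open>card (B e0) = 3\<close>] \<tau>Bf(1) not_in by auto
      then have "f2 \<in> B f1" using f2 by (simp add: B_def)
      then have "card (B f1 - {f1, f2}) = 1"
        using True self(1)[OF f1(1)] f12 by (simp add: card_Diff_subset)
      then obtain f3 where "B f1 - {f1, f2} = {f3}" by (meson card_1_singletonE)
      then have f3: "B f1 = {f1, f2, f3}" "f3 \<noteq> f1" "f3 \<noteq> f2"
        using self(1)[OF f1(1)] \<open>f2 \<in> B f1\<close> by blast+
      have Bf: "B f2 = {f1, f2, f3}" "B f3 = {f1, f2, f3}"
        using B_eq[of f2 f1] B_eq[of f3 f1] f3(1) by auto
      have f3E: "f3 \<in> E" "b f3 = b f1" using sub(1)[of f1] b_eq[of f3 f1] f3(1) by auto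
      then have "f3 \<noteq> e0" using not_in by auto
      \<comment> \<open>Beyond the white end of the third edge \<open>f3\<close>, the next edge
        either has a black end of degree 1 or is already among the six found, since there is no
        further black vertex of degree 3.\<close>
      then obtain f4 where f4: "f4 \<in> E" "f4 \<noteq> f3" "W f3 = {f3, f4}" using W2 f3E(1) by blast
      then have Wf4: "W f4 = {f3, f4}" using W_eq[of f4 f3] by simp
      show False
      proof (cases "card (B f4) = 3")
        case True
        then have "b f4 = b e0 \<or> b f4 = b f1"
          using card_B3[OF e0(1) f1(1) f4(1) \<open>card (B e0) = 3\<close> \<open>card (B f1) = 3\<close>] not_in by auto
        then have "f4 \<in> B e0 \<or> f4 \<in> B f1" using f4(1) by (auto simp: B_def)
        then have "f4 \<in> {e0, e1, e2, f1, f2, f3}" using Be0 f3(1) by auto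
        then show False
          using small[of "[e0, e1, e2, f1, f2, f3]"] e0(1) inE f1(1) f2 f3E We0 f1(3) Wf1 We2 Wf2 f4(3) Be0 Be12 f3(1) Bf
          by auto
      next
        case False
        then have "B f4 = {f4}" using B1 f4(1) by blast
        then show False
          using small[of "[e0, e1, e2, f1, f2, f3, f4]"] e0(1) inE f1(1) f2 f3E f4(1)
            We0 f1(3) Wf1 We2 Wf2 f4(3) Wf4 Be0 Be12 f3(1) Bf
          by auto
      qed
    qed
  qed
  moreover have "\<tau> e2 = e2"
    using calculation ne' im by blast
  ultimately show ?thesis
    using that[OF e0(1) \<open>card (B e0) = 3\<close>] Be0 \<tau>e0 by auto
qed

section \<open>Transport of trees along homeomorphisms of the plane\<close>

lemma components_homeomorphic_image:
  fixes T T' :: "complex \<Rightarrow> complex"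
  assumes "continuous_on UNIV T" "continuous_on UNIV T'" "\<And>x. T' (T x) = x" "\<And>x. T (T' x) = x"
  shows "components (T ` S) = (`) T ` components S"
proof -
  have sub: "(`) f ` components A \<subseteq> components (f ` A)"
    if f: "continuous_on UNIV f" "continuous_on UNIV g" "\<And>x. g (f x) = x" "\<And>x. f (g x) = x"
    for f g :: "complex \<Rightarrow> complex" and A
  proof
    fix C' assume "C' \<in> (`) f ` components A"
    then obtain C where C: "C \<in> components A" "C' = f ` C" by auto
    have C_max: "C \<subseteq> A" "C \<noteq> {}" "connected C"
        "\<And>D. \<lbrakk>D \<noteq> {}; C \<subseteq> D; D \<subseteq> A; connected D\<rbrakk> \<Longrightarrow> D = C"
      using C(1) unfolding in_components_maximal by blast+
    show "C' \<in> components (f ` A)"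
      unfolding in_components_maximal C(2)
    proof (intro conjI allI impI)
      show "connected (f ` C)"
        by (rule connected_continuous_image[OF continuous_on_subset[OF f(1)] C_max(3)]) simp
      fix D assume D: "D \<noteq> {} \<and> f ` C \<subseteq> D \<and> D \<subseteq> f ` A \<and> connected D"
      have "connected (g ` D)"
        using D by (intro connected_continuous_image continuous_on_subset[OF f(2)]) auto
      moreover have "C \<subseteq> g ` D"
      proof
        fix x assume "x \<in> C"
        then have "f x \<in> D" using D by blast
        then show "x \<in> g ` D" by (rule image_eqI[where f=g, OF f(3)[of x, symmetric]])
      qed
      moreover have "g ` D \<subseteq> A" using D f(3) by auto
      ultimately have "g ` D = C" using D by (intro C_max(4)) simp_all
      then have "f ` g ` D = f ` C" by simp
      then show "D = f ` C" by (simp add: image_image f(4))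
    qed (use C_max in auto)
  qed
  show ?thesis
  proof
    show "(`) T ` components S \<subseteq> components (T ` S)" by (rule sub[OF assms])
    have "(`) T' ` components (T ` S) \<subseteq> components (T' ` T ` S)"
      by (rule sub) (use assms in auto)
    then have *: "(`) T' ` components (T ` S) \<subseteq> components S"
      by (simp add: image_image assms(3))
    show "components (T ` S) \<subseteq> (`) T ` components S"
    proof
      fix C assume "C \<in> components (T ` S)"
      then have "T' ` C \<in> components S" using * by blast
      moreover have "C = T ` T' ` C" by (simp add: image_image assms(4))
      ultimately show "C \<in> (`) T ` components S" by (rule rev_image_eqI)
    qed
  qed
qed

lemma closure_homeomorphic_image:
  fixes T T' :: "complex \<Rightarrow> complex"
  assumes "continuous_on UNIV T" "continuous_on UNIV T'" "\<And>x. T' (T x) = x" "\<And>x. T (T' x) = x"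
  shows "closure (T ` S) = T ` closure S"
proof
  show "T ` closure S \<subseteq> closure (T ` S)"
    by (rule image_closure_subset[OF continuous_on_subset[OF assms(1)]]) (simp_all add: closure_subset)
  have "T' ` closure (T ` S) \<subseteq> closure (T' ` T ` S)"
    by (rule image_closure_subset[OF continuous_on_subset[OF assms(2)]]) (simp_all add: closure_subset)
  then have "T' ` closure (T ` S) \<subseteq> closure S"
    by (simp add: image_image assms(3))
  then have "T ` T' ` closure (T ` S) \<subseteq> T ` closure S" by (rule image_mono)
  then show "closure (T ` S) \<subseteq> T ` closure S" by (simp add: image_image assms(4))
qed

text \<open>\<open>M\<close> is the action of \<open>T\<close> on directions; \<open>T\<close> will be an affine map or complex conjugation.\<close>

locale tree_transport = shabat_tree P c1 c2 for P c1 c2 +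
  fixes Q d1 d2 and T T' M :: "complex \<Rightarrow> complex"
  assumes cont: "continuous_on UNIV T" "continuous_on UNIV T'"
    and inv: "\<And>x. T' (T x) = x" "\<And>x. T (T' x) = x"
    and seg: "\<And>z. poly Q (T z) \<in> open_segment d1 d2 \<longleftrightarrow> poly P z \<in> open_segment c1 c2"
    and col1: "\<And>z. poly Q (T z) = d1 \<longleftrightarrow> poly P z = c1"
    and col2: "\<And>z. poly Q (T z) = d2 \<longleftrightarrow> poly P z = c2"
    and contM: "continuous_on UNIV M"
    and sgn: "\<And>z v. sgn (T z - T v) = M (sgn (z - v))"
begin

lemma inj_transport: "inj T"
  by (metis inv(1) injI)

lemma inj_image_transport: "T ` A = T ` B \<longleftrightarrow> A = B"
  using inj_transport by (rule inj_image_eq_iff)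

lemma vertices1: "tree_vertices Q d1 = T ` tree_vertices P c1"
proof (intro equalityI subsetI)
  fix x assume "x \<in> tree_vertices Q d1"
  then have "T' x \<in> tree_vertices P c1" using col1[of "T' x"] by (simp add: tree_vertices_def inv)
  then show "x \<in> T ` tree_vertices P c1" by (rule image_eqI[where f=T, OF inv(2)[of x, symmetric]])
qed (auto simp: tree_vertices_def col1)

lemma vertices2: "tree_vertices Q d2 = T ` tree_vertices P c2"
proof (intro equalityI subsetI)
  fix x assume "x \<in> tree_vertices Q d2"
  then have "T' x \<in> tree_vertices P c2" using col2[of "T' x"] by (simp add: tree_vertices_def inv)
  then show "x \<in> T ` tree_vertices P c2" by (rule image_eqI[where f=T, OF inv(2)[of x, symmetric]])
qed (auto simp: tree_vertices_def col2)

lemma edges: "tree_edges Q d1 d2 = (`) T ` tree_edges P c1 c2"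
proof -
  have "{z. poly Q z \<in> open_segment d1 d2} = T ` {z. poly P z \<in> open_segment c1 c2}"
  proof (intro equalityI subsetI)
    fix x assume "x \<in> {z. poly Q z \<in> open_segment d1 d2}"
    then have "T' x \<in> {z. poly P z \<in> open_segment c1 c2}" using seg[of "T' x"] by (simp add: inv)
    then show "x \<in> T ` {z. poly P z \<in> open_segment c1 c2}" by (rule image_eqI[where f=T, OF inv(2)[of x, symmetric]])
  qed (auto simp: seg)
  then show ?thesis
    unfolding tree_edges_def by (simp only: components_homeomorphic_image[OF cont inv])
qed

lemma edges_at: "edges_at Q d1 d2 (T v) = (`) T ` edges_at P c1 c2 v"
proof -
  have "T v \<in> closure (T ` e) \<longleftrightarrow> v \<in> closure e" for e
    unfolding closure_homeomorphic_image[OF cont inv] using inj_transport by (rule inj_image_mem_iff)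
  then show ?thesis
    unfolding edges_at_def edges by auto
qed

lemma edges_at_iff: "T ` e \<in> edges_at Q d1 d2 (T v) \<longleftrightarrow> e \<in> edges_at P c1 c2 v"
  unfolding edges_at by (auto simp: inj_image_transport)

text \<open>The limit at \<open>T v\<close> is pulled back along \<open>T'\<close> to the limit at
  \<open>v\<close>, where \<open>sgn (x - T v)\<close> becomes
  \<open>M (sgn (T' x - v))\<close>.\<close>

lemma direction:
  assumes v: "v \<in> tree_vertices P c1 \<union> tree_vertices P c2" and e: "e \<in> edges_at P c1 c2 v"
  shows "edge_direction (T v) (T ` e) = M (edge_direction v e)"
proof -
  note lim = edge_direction_limit[OF v e]
  have "filterlim T (at (T v) within T ` e) (at v within e)"
    unfolding filterlim_at
  proof (intro conjI)
    show "(T \<longlongrightarrow> T v) (at v within e)"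
      using cont(1) by (metis continuous_on_eq_continuous_at continuous_at_imp_continuous_at_within
          continuous_within UNIV_I open_UNIV)
    show "\<forall>\<^sub>F x in at v within e. T x \<in> T ` e \<and> T x \<noteq> T v"
      using inv(1) by (auto simp: eventually_at_filter intro!: always_eventually) metis
  qed
  then have ntriv: "at (T v) within T ` e \<noteq> bot"
    using lim(2) unfolding filterlim_def by (auto simp: bot_unique filtermap_bot_iff)
  have "filterlim T' (at v within e) (at (T v) within T ` e)"
    unfolding filterlim_at
  proof (intro conjI)
    have "(T' \<longlongrightarrow> T' (T v)) (at (T v) within T ` e)"
      using cont(2) by (metis continuous_on_eq_continuous_at continuous_at_imp_continuous_at_within
          continuous_within UNIV_I open_UNIV)
    then show "(T' \<longlongrightarrow> v) (at (T v) within T ` e)" by (simp add: inv)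
    show "\<forall>\<^sub>F x in at (T v) within T ` e. T' x \<in> e \<and> T' x \<noteq> v"
      using inv by (auto simp: eventually_at_filter intro!: always_eventually)
  qed
  then have "((\<lambda>x. sgn (T' x - v)) \<longlongrightarrow> edge_direction v e) (at (T v) within T ` e)"
    by (rule filterlim_compose[OF lim(3)])
  moreover have "isCont M (edge_direction v e)"
    using contM by (simp add: continuous_on_eq_continuous_at)
  ultimately have "((\<lambda>x. M (sgn (T' x - v))) \<longlongrightarrow> M (edge_direction v e)) (at (T v) within T ` e)"
    by (rule isCont_tendsto_compose[rotated])
  then have "((\<lambda>x. sgn (x - T v)) \<longlongrightarrow> M (edge_direction v e)) (at (T v) within T ` e)"
    by (simp add: sgn[symmetric] inv)
  then show ?thesis
    unfolding edge_direction_def[of "T v"] by (rule tendsto_Lim[OF ntriv])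
qed

text \<open>Preservation of quotients makes \<open>M\<close> preserve counterclockwise angles.
  Rotations satisfy this; conjugation does not, and for it only the other facts of the locale are
  available.\<close>

lemma tree_iso_transport:
  assumes M: "\<And>x y. M x / M y = x / y"
  shows "tree_iso P c1 c2 Q d1 d2"
  unfolding tree_iso_def
proof (intro exI conjI ballI)
  show "bij_betw T (tree_vertices P c1) (tree_vertices Q d1)"
    "bij_betw T (tree_vertices P c2) (tree_vertices Q d2)"
    using inj_transport by (auto simp: bij_betw_def vertices1 vertices2 intro: inj_on_subset)
  show "bij_betw ((`) T) (tree_edges P c1 c2) (tree_edges Q d1 d2)"
    by (auto simp: bij_betw_def edges inj_on_def inj_image_transport)
  fix v assume v: "v \<in> tree_vertices P c1 \<union> tree_vertices P c2"
  show "e \<in> edges_at P c1 c2 v \<longleftrightarrow> T ` e \<in> edges_at Q d1 d2 (T v)" for e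
    by (simp add: edges_at_iff)
  have ang: "ccw_angle (T v) (T ` e) (T ` e') = ccw_angle v e e'"
    if "e \<in> edges_at P c1 c2 v" "e' \<in> edges_at P c1 c2 v" for e e'
    using that by (simp add: ccw_angle_def direction[OF v] M)
  show "ccw_next P c1 c2 v e e' \<longleftrightarrow> ccw_next Q d1 d2 (T v) (T ` e) (T ` e')" for e e'
  proof (cases "e \<in> edges_at P c1 c2 v \<and> e' \<in> edges_at P c1 c2 v")
    case True
    have "edges_at Q d1 d2 (T v) = {T ` e} \<longleftrightarrow> edges_at P c1 c2 v = {e}"
      unfolding edges_at using inj_image_eq_iff[of "(`) T" _ "{e}"] inj_image_transport
      by (simp add: inj_def)
    moreover have "edges_at Q d1 d2 (T v) - {T ` e} = (`) T ` (edges_at P c1 c2 v - {e})"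
      unfolding edges_at by (auto simp: inj_image_transport)
    ultimately show ?thesis
      using True ang unfolding ccw_next_def by (auto simp: inj_image_transport edges_at_iff)
  next
    case False
    then show ?thesis by (auto simp: ccw_next_def edges_at_iff)
  qed
qed

end

lemma shabat_equiv_imp_tree_iso:
  assumes P: "shabat P c1 c2" and eq: "shabat_equiv P c1 c2 Q d1 d2"
  shows "tree_iso P c1 c2 Q d1 d2"
proof -
  obtain A B a b where A: "A \<noteq> 0" "a \<noteq> 0" and Q: "\<And>x. poly Q x = A * poly P (a * x + b) + B"
    and d: "d1 = A * c1 + B" "d2 = A * c2 + B"
    using eq by (auto simp: shabat_equiv_def)
  have c: "c1 \<noteq> c2" using P by (simp add: shabat_def)
  then have d12: "d1 \<noteq> d2" using A d by simp
  have QT: "poly Q ((z - b) / a) = A * poly P z + B" for z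
    using A by (simp add: Q)
  \<comment> \<open>\<open>T\<close> is the inverse of x -> a x + b, since \<open>Q\<close> after
    this inverse is A P + B. Dividing by \<open>a\<close> rotates directions by the inverse of
    \<open>sgn a\<close>.\<close>
  interpret tree_transport P c1 c2 Q d1 d2 "\<lambda>z. (z - b) / a" "\<lambda>x. a * x + b" "\<lambda>s. s / sgn a"
  proof unfold_locales
    fix z v
    have "A * w + B = d1 + (d2 - d1) * of_real t \<longleftrightarrow> w = c1 + (c2 - c1) * of_real t" for w t
    proof -
      have "A * w + B = d1 + (d2 - d1) * of_real t \<longleftrightarrow> A * w = A * (c1 + (c2 - c1) * of_real t)"
        by (simp add: d algebra_simps)
      then show ?thesis using A(1) by simp
    qed
    then show "poly Q ((z - b) / a) \<in> open_segment d1 d2 \<longleftrightarrow> poly P z \<in> open_segment c1 c2"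
      by (simp add: QT open_segment_iff_affine[OF c] open_segment_iff_affine[OF d12])
    have "(z - b) / a - (v - b) / a = (z - v) / a"
      by (simp add: diff_divide_distrib)
    then show "sgn ((z - b) / a - (v - b) / a) = sgn (z - v) / sgn a"
      by (simp add: sgn_divide)
  qed (use P A in \<open>auto simp: QT d sgn_zero_iff intro!: continuous_intros\<close>)
  show ?thesis
    by (rule tree_iso_transport) (use A in \<open>simp add: sgn_zero_iff\<close>)
qed

lemma tree_iso_trans:
  assumes "tree_iso P c1 c2 Q d1 d2" "tree_iso Q d1 d2 R r1 r2"
  shows "tree_iso P c1 c2 R r1 r2"
proof -
  obtain f g where f: "bij_betw f (tree_vertices P c1) (tree_vertices Q d1)"
      "bij_betw f (tree_vertices P c2) (tree_vertices Q d2)"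
      "bij_betw g (tree_edges P c1 c2) (tree_edges Q d1 d2)"
    and fg: "\<forall>v \<in> tree_vertices P c1 \<union> tree_vertices P c2.
           (\<forall>e \<in> tree_edges P c1 c2. e \<in> edges_at P c1 c2 v \<longleftrightarrow> g e \<in> edges_at Q d1 d2 (f v)) \<and>
           (\<forall>e \<in> tree_edges P c1 c2. \<forall>e' \<in> tree_edges P c1 c2.
              ccw_next P c1 c2 v e e' \<longleftrightarrow> ccw_next Q d1 d2 (f v) (g e) (g e'))"
    using assms(1) unfolding tree_iso_def by (elim exE conjE) (rule that)
  obtain f' g' where f': "bij_betw f' (tree_vertices Q d1) (tree_vertices R r1)"
      "bij_betw f' (tree_vertices Q d2) (tree_vertices R r2)"
      "bij_betw g' (tree_edges Q d1 d2) (tree_edges R r1 r2)"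
    and fg': "\<forall>v \<in> tree_vertices Q d1 \<union> tree_vertices Q d2.
           (\<forall>e \<in> tree_edges Q d1 d2. e \<in> edges_at Q d1 d2 v \<longleftrightarrow> g' e \<in> edges_at R r1 r2 (f' v)) \<and>
           (\<forall>e \<in> tree_edges Q d1 d2. \<forall>e' \<in> tree_edges Q d1 d2.
              ccw_next Q d1 d2 v e e' \<longleftrightarrow> ccw_next R r1 r2 (f' v) (g' e) (g' e'))"
    using assms(2) unfolding tree_iso_def by (elim exE conjE) (rule that)
  have fv: "f v \<in> tree_vertices Q d1 \<union> tree_vertices Q d2"
    if "v \<in> tree_vertices P c1 \<union> tree_vertices P c2" for v
    using that f(1,2) by (auto dest: bij_betwE)
  have ge: "g e \<in> tree_edges Q d1 d2" if "e \<in> tree_edges P c1 c2" for e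
    using that f(3) by (auto dest: bij_betwE)
  show ?thesis
    unfolding tree_iso_def
  proof (intro exI[of _ "f' \<circ> f"] exI[of _ "g' \<circ> g"] conjI ballI)
    fix v assume v: "v \<in> tree_vertices P c1 \<union> tree_vertices P c2"
    note iso = bspec[OF fg v] bspec[OF fg' fv[OF v]]
    show "e \<in> edges_at P c1 c2 v \<longleftrightarrow> (g' \<circ> g) e \<in> edges_at R r1 r2 ((f' \<circ> f) v)"
      if "e \<in> tree_edges P c1 c2" for e
      using iso that ge by simp
    show "ccw_next P c1 c2 v e e' \<longleftrightarrow> ccw_next R r1 r2 ((f' \<circ> f) v) ((g' \<circ> g) e) ((g' \<circ> g) e')"
      if "e \<in> tree_edges P c1 c2" "e' \<in> tree_edges P c1 c2" for e e'
      using iso that ge by simp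
  qed (rule bij_betw_trans[OF f(1) f'(1)] bij_betw_trans[OF f(2) f'(2)] bij_betw_trans[OF f(3) f'(3)])+
qed

lemma shabat_equiv_sym:
  assumes "shabat_equiv P c1 c2 Q d1 d2"
  shows "shabat_equiv Q d1 d2 P c1 c2"
proof -
  obtain A B a b where A: "A \<noteq> 0" "a \<noteq> 0" and Q: "\<And>x. poly Q x = A * poly P (a * x + b) + B"
    and d: "d1 = A * c1 + B" "d2 = A * c2 + B"
    using assms by (auto simp: shabat_equiv_def)
  have "poly P x = 1 / A * poly Q (1 / a * x + - b / a) + - B / A" for x
    using A by (simp add: Q field_simps)
  moreover have "c1 = 1 / A * d1 + - B / A" "c2 = 1 / A * d2 + - B / A"
    using A d by (simp_all add: field_simps)
  ultimately show ?thesis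
    using A unfolding shabat_equiv_def
    by (intro exI[of _ "1 / A"] exI[of _ "- B / A"] exI[of _ "1 / a"] exI[of _ "- b / a"]) simp
qed

section \<open>Angles between edges and the mirror image\<close>

context shabat_tree
begin

lemma norm_edge_direction:
  assumes "v \<in> tree_vertices P c1 \<union> tree_vertices P c2" "e \<in> edges_at P c1 c2 v"
  shows "norm (edge_direction v e) = 1"
proof -
  note lim = edge_direction_limit[OF assms]
  have "((\<lambda>z. norm (sgn (z - v))) \<longlongrightarrow> norm (edge_direction v e)) (at v within e)"
    by (rule tendsto_norm[OF lim(3)])
  moreover have "\<forall>\<^sub>F z in at v within e. norm (sgn (z - v)) = 1"
    unfolding eventually_at_filter by (auto simp: norm_sgn)
  then have "((\<lambda>z. norm (sgn (z - v))) \<longlongrightarrow> 1) (at v within e)"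
    by (rule tendsto_eventually)
  ultimately show ?thesis
    using tendsto_unique[OF lim(2)] by blast
qed

text \<open>Equal angles mean proportional directions with a positive factor; directions are unit
  vectors, so they coincide, and distinct edges at \<open>v\<close> have distinct
  directions.\<close>

lemma ccw_angle_inj:
  assumes v: "v \<in> tree_vertices P c1 \<union> tree_vertices P c2"
    and e: "e \<in> edges_at P c1 c2 v" "e' \<in> edges_at P c1 c2 v" "e'' \<in> edges_at P c1 c2 v"
    and eq: "ccw_angle v e e' = ccw_angle v e e''"
  shows "e' = e''"
proof -
  let ?d = "edge_direction v"
  note n = norm_edge_direction[OF v]
  have nz: "?d e \<noteq> 0" "?d e' \<noteq> 0" "?d e'' \<noteq> 0"
    using n[OF e(1)] n[OF e(2)] n[OF e(3)] by auto
  then obtain r where r: "0 < r" "?d e' / ?d e = of_real r * (?d e'' / ?d e)"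
    using eq Arg2pi_eq_iff[of "?d e' / ?d e" "?d e'' / ?d e"] by (auto simp: ccw_angle_def)
  then have d: "?d e' = of_real r * ?d e''" using nz by (simp add: field_simps)
  then have "norm (?d e') = r * norm (?d e'')" using r(1) by (simp add: norm_mult)
  then have "r = 1" using n e by simp
  then have "?d e' = ?d e''" using d by simp
  then show ?thesis using inj_onD[OF inj_edge_direction[OF v]] e by blast
qed

lemma ccw_angle_nonzero:
  assumes v: "v \<in> tree_vertices P c1 \<union> tree_vertices P c2"
    and e: "e \<in> edges_at P c1 c2 v" "e' \<in> edges_at P c1 c2 v" "e' \<noteq> e"
  shows "ccw_angle v e e' \<noteq> 0"
proof
  have "ccw_angle v e e = 0"
    using norm_edge_direction[OF v e(1)] by (auto simp: ccw_angle_def Arg2pi_eq_0)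
  moreover assume "ccw_angle v e e' = 0"
  ultimately show False using ccw_angle_inj[OF v e(1) e(2) e(1)] e(3) by simp
qed

end

lemma Arg2pi_cnj_nonzero: "Arg2pi z \<noteq> 0 \<Longrightarrow> Arg2pi (cnj z) = 2 * pi - Arg2pi z"
  using Arg2pi_cnj[of z] Arg2pi_eq_0[of z] Arg2pi_eq_0_pi by auto

text \<open>Following the supposed isomorphism by conjugation gives an automorphism \<tau> of the
  incidence structure. On a star fixed by \<tau> the edge map \<open>g\<close> is itself
  conjugation, yet it would have to respect the counterclockwise order.\<close>

lemma not_tree_iso_mirror:
  assumes P: "shabat P c1 c2" and pp: "has_passport P c1 c2 {#3, 3, 1, 1, 1#} {#2, 2, 2, 2, 1#} 9"
  shows "\<not> tree_iso P c1 c2 (map_poly cnj P) (cnj c1) (cnj c2)"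
proof
  let ?Q = "map_poly cnj P"
  assume "tree_iso P c1 c2 ?Q (cnj c1) (cnj c2)"
  then obtain f g where f1: "bij_betw f (tree_vertices P c1) (tree_vertices ?Q (cnj c1))"
      and f2: "bij_betw f (tree_vertices P c2) (tree_vertices ?Q (cnj c2))"
      and g: "bij_betw g (tree_edges P c1 c2) (tree_edges ?Q (cnj c1) (cnj c2))"
    and fg: "\<forall>v \<in> tree_vertices P c1 \<union> tree_vertices P c2.
           (\<forall>e \<in> tree_edges P c1 c2. e \<in> edges_at P c1 c2 v \<longleftrightarrow> g e \<in> edges_at ?Q (cnj c1) (cnj c2) (f v)) \<and>
           (\<forall>e \<in> tree_edges P c1 c2. \<forall>e' \<in> tree_edges P c1 c2.
              ccw_next P c1 c2 v e e' \<longleftrightarrow> ccw_next ?Q (cnj c1) (cnj c2) (f v) (g e) (g e'))"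
    unfolding tree_iso_def by (elim exE conjE) (rule that)
  have c: "c1 \<noteq> c2" using P by (simp add: shabat_def)
  interpret tree_transport P c1 c2 ?Q "cnj c1" "cnj c2" cnj cnj cnj
  proof unfold_locales
    fix z v
    have "cnj w = cnj c1 + (cnj c2 - cnj c1) * of_real t \<longleftrightarrow> w = c1 + (c2 - c1) * of_real t" for w t
      by (metis complex_cnj_add complex_cnj_cnj complex_cnj_complex_of_real complex_cnj_diff complex_cnj_mult)
    moreover have "cnj c1 \<noteq> cnj c2" using c by simp
    ultimately show "poly ?Q (cnj z) \<in> open_segment (cnj c1) (cnj c2) \<longleftrightarrow> poly P z \<in> open_segment c1 c2"
      by (simp add: open_segment_iff_affine[OF c] open_segment_iff_affine)
    show "sgn (cnj z - cnj v) = cnj (sgn (z - v))"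
      by (simp add: sgn_eq flip: complex_cnj_diff)
  qed (use P in \<open>auto intro!: continuous_intros\<close>)
  let ?V1 = "tree_vertices P c1" and ?V2 = "tree_vertices P c2" and ?E = "tree_edges P c1 c2"
  let ?at = "edges_at P c1 c2"
  \<comment> \<open>Conjugation is its own inverse, so these maps lead back to the tree of
    \<open>P\<close>. Only incidence is extracted from them; the cyclic orders are used at the very
    end.\<close>
  define \<sigma> where "\<sigma> v = cnj (f v)" for v
  define \<tau> where "\<tau> e = cnj ` g e" for e
  have cnj_im: "cnj ` cnj ` A = A" for A by (simp add: image_image)
  have bij_cnj_im: "bij_betw ((`) cnj) ((`) cnj ` A) A" for A :: "complex set set"
    by (auto simp: bij_betw_def inj_on_def inj_image_transport image_image cnj_im)
  have bij_cnj: "bij_betw cnj (cnj ` A) A" for A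
    by (auto simp: bij_betw_def inj_on_def image_image)
  have \<sigma>1: "bij_betw \<sigma> ?V1 ?V1"
    using bij_betw_trans[OF f1] bij_cnj[of ?V1] unfolding vertices1 by (simp add: \<sigma>_def[abs_def] o_def)
  have \<sigma>2: "bij_betw \<sigma> ?V2 ?V2"
    using bij_betw_trans[OF f2] bij_cnj[of ?V2] unfolding vertices2 by (simp add: \<sigma>_def[abs_def] o_def)
  have \<tau>: "bij_betw \<tau> ?E ?E"
    using bij_betw_trans[OF g] bij_cnj_im[of ?E] unfolding edges by (simp add: \<tau>_def[abs_def] o_def)
  have inc: "e \<in> ?at v \<longleftrightarrow> \<tau> e \<in> ?at (\<sigma> v)" if v: "v \<in> ?V1 \<union> ?V2" and e: "e \<in> ?E" for v e
  proof -
    have "e \<in> ?at v \<longleftrightarrow> g e \<in> edges_at ?Q (cnj c1) (cnj c2) (f v)" using fg v e by blast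
    also have "\<dots> \<longleftrightarrow> cnj ` \<tau> e \<in> edges_at ?Q (cnj c1) (cnj c2) (cnj (\<sigma> v))"
      by (simp add: \<tau>_def \<sigma>_def cnj_im)
    finally show ?thesis by (simp only: edges_at_iff)
  qed
  have \<tau>E: "\<tau> e \<in> ?E" if "e \<in> ?E" for e using \<tau> that by (auto dest: bij_betwE)
  define b where "b e = (THE v. v \<in> ?V1 \<and> e \<in> ?at v)" for e
  define w where "w e = (THE v. v \<in> ?V2 \<and> e \<in> ?at v)" for e
  have b: "b e \<in> ?V1" "e \<in> ?at (b e)" if "e \<in> ?E" for e
    using theI'[OF edge_endpoint1[OF that]] by (simp_all add: b_def)
  have w: "w e \<in> ?V2" "e \<in> ?at (w e)" if "e \<in> ?E" for e
    using theI'[OF edge_endpoint2[OF that]] by (simp_all add: w_def)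
  have b_eqI: "b e = v" if "v \<in> ?V1" "e \<in> ?at v" for e v
    using edge_endpoint1[OF edges_atD[OF that(2)]] b[OF edges_atD[OF that(2)]] that by blast
  have w_eqI: "w e = v" if "v \<in> ?V2" "e \<in> ?at v" for e v
    using edge_endpoint2[OF edges_atD[OF that(2)]] w[OF edges_atD[OF that(2)]] that by blast
  have at_b: "?at (b e) = {e' \<in> ?E. b e' = b e}" if "e \<in> ?E" for e
  proof (rule set_eqI)
    show "x \<in> ?at (b e) \<longleftrightarrow> x \<in> {e' \<in> ?E. b e' = b e}" for x
      using b(1)[OF that] b(2)[of x] b_eqI[of "b e" x] edges_atD[of x "b e"] by auto
  qed
  have at_w: "?at (w e) = {e' \<in> ?E. w e' = w e}" if "e \<in> ?E" for e
  proof (rule set_eqI)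
    show "x \<in> ?at (w e) \<longleftrightarrow> x \<in> {e' \<in> ?E. w e' = w e}" for x
      using w(1)[OF that] w(2)[of x] w_eqI[of "w e" x] edges_atD[of x "w e"] by auto
  qed
  have b\<tau>: "b (\<tau> e) = \<sigma> (b e)" if "e \<in> ?E" for e
    using b[OF that] inc[of "b e" e] that \<sigma>1 by (intro b_eqI) (auto dest: bij_betwE)
  have w\<tau>: "w (\<tau> e) = \<sigma> (w e)" if "e \<in> ?E" for e
    using w[OF that] inc[of "w e" e] that \<sigma>2 by (intro w_eqI) (auto dest: bij_betwE)
  have deg1: "vertex_degrees P c1 = {#3, 3, 1, 1, 1#}" and deg2: "vertex_degrees P c2 = {#2, 2, 2, 2, 1#}"
    and deg: "degree P = 9"
    using pp by (auto simp: has_passport_def)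
  have count1: "card {v \<in> ?V1. card (?at v) = k} = count {#3, 3, 1, 1, 1#} k" for k
    unfolding deg1[symmetric] card_vertices_of_order[OF degree_pos, symmetric]
    by (intro arg_cong[of _ _ card]) (auto simp: card_edges_at1)
  have count2: "card {v \<in> ?V2. card (?at v) = k} = count {#2, 2, 2, 2, 1#} k" for k
    unfolding deg2[symmetric] card_vertices_of_order[OF degree_pos, symmetric]
    by (intro arg_cong[of _ _ card]) (auto simp: card_edges_at2)
  have at1: "card (?at v) \<in> {1, 3}" if "v \<in> ?V1" for v
  proof -
    have "card {u \<in> ?V1. card (?at u) = card (?at v)} \<noteq> 0"
      using that finite_vertices[of c1] by auto
    then show ?thesis by (auto simp: count1 split: if_splits)
  qed
  have at2: "card (?at v) \<in> {1, 2}" if "v \<in> ?V2" for v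
  proof -
    have "card {u \<in> ?V2. card (?at u) = card (?at v)} \<noteq> 0"
      using that finite_vertices[of c2] by auto
    then show ?thesis by (auto simp: count2 split: if_splits)
  qed
  obtain e where e: "e \<in> ?E" "card {e' \<in> ?E. b e' = b e} = 3" "\<And>e'. e' \<in> {e' \<in> ?E. b e' = b e} \<Longrightarrow> \<tau> e' = e'"
  proof (rule fixed_star_of_automorphism[of ?E \<tau> b w])
    show "7 < card ?E" by (simp add: card_tree_edges deg)
    show "bij_betw \<tau> ?E ?E" by (rule \<tau>)
    show "b (\<tau> e) = b (\<tau> e') \<longleftrightarrow> b e = b e'" if "e \<in> ?E" "e' \<in> ?E" for e e'
      using that b\<tau> b \<sigma>1 by (auto simp: bij_betw_def inj_on_def)
    show "w (\<tau> e) = w (\<tau> e') \<longleftrightarrow> w e = w e'" if "e \<in> ?E" "e' \<in> ?E" for e e'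
      using that w\<tau> w \<sigma>2 by (auto simp: bij_betw_def inj_on_def)
    show "card {e' \<in> ?E. b e' = b e} \<in> {1, 3}" if "e \<in> ?E" for e
      using at1[OF b(1)[OF that]] at_b[OF that] by simp
    show "card {e' \<in> ?E. w e' = w e} \<in> {1, 2}" if "e \<in> ?E" for e
      using at2[OF w(1)[OF that]] at_w[OF that] by simp
    show "b e = b e' \<or> b e = b e'' \<or> b e' = b e''"
      if "e \<in> ?E" "e' \<in> ?E" "e'' \<in> ?E" "card {x \<in> ?E. b x = b e} = 3"
        "card {x \<in> ?E. b x = b e'} = 3" "card {x \<in> ?E. b x = b e''} = 3" for e e' e''
    proof (rule ccontr)
      assume "\<not> ?thesis"
      then have "card {b e, b e', b e''} = 3" by simp
      moreover have "{b e, b e', b e''} \<subseteq> {v \<in> ?V1. card (?at v) = 3}"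
        using that b(1) at_b by simp
      ultimately have "3 \<le> card {v \<in> ?V1. card (?at v) = 3}"
        using card_mono[of "{v \<in> ?V1. card (?at v) = 3}" "{b e, b e', b e''}"] finite_vertices[of c1] by simp
      then show False by (simp add: count1)
    qed
    show "\<exists>!e. e \<in> ?E \<and> card {e' \<in> ?E. w e' = w e} = 1"
    proof -
      have "card {v \<in> ?V2. card (?at v) = 1} = 1" by (simp add: count2)
      then obtain v where v: "{v \<in> ?V2. card (?at v) = 1} = {v}" by (meson card_1_singletonE)
      then have "v \<in> ?V2" "card (?at v) = 1" by blast+
      then obtain e where e: "?at v = {e}" by (meson card_1_singletonE)
      show ?thesis
      proof (intro ex1I[of _ e] conjI)
        show "e \<in> ?E" using e edges_atD by blast
        have "w e = v" using w_eqI \<open>v \<in> ?V2\<close> e by blast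
        then show "card {e' \<in> ?E. w e' = w e} = 1"
          using at_w[OF \<open>e \<in> ?E\<close>] \<open>card (?at v) = 1\<close> by simp
        fix e' assume e': "e' \<in> ?E \<and> card {x \<in> ?E. w x = w e'} = 1"
        then have "w e' \<in> {v \<in> ?V2. card (?at v) = 1}"
          using w(1) at_w by simp
        then have "w e' = v" using v by blast
        then show "e' = e" using w(2)[of e'] e e' by simp
      qed
    qed
    show "F = ?E" if F: "F \<subseteq> ?E" "F \<noteq> {}" and FB: "\<And>e. e \<in> F \<Longrightarrow> {e' \<in> ?E. b e' = b e} \<subseteq> F"
      and FW: "\<And>e. e \<in> F \<Longrightarrow> {e' \<in> ?E. w e' = w e} \<subseteq> F" for F
    proof -
      \<comment> \<open>The ends of the edges in \<open>F\<close> form a vertex set closed under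
        adjacency.\<close>
      have "b ` F \<union> w ` F = ?V1 \<union> ?V2"
      proof (rule vertex_set_closed_under_adjacency)
        show "b ` F \<union> w ` F \<subseteq> ?V1 \<union> ?V2" using F(1) b(1) w(1) by blast
        show "b ` F \<union> w ` F \<noteq> {}" using F(2) by blast
        fix v v' e assume v: "v \<in> b ` F \<union> w ` F" and v': "v' \<in> ?V1 \<union> ?V2" and e: "e \<in> ?at v" "e \<in> ?at v'"
        have eE: "e \<in> ?E" using e(1) by (rule edges_atD)
        have "e \<in> F"
        proof (cases "v \<in> b ` F")
          case True
          then obtain x where x: "x \<in> F" "v = b x" by blast
          then have "b e = b x" using b_eqI[of v e] e(1) b(1)[of x] F(1) by auto
          then show ?thesis using FB[OF x(1)] eE by blast
        next
          case False
          then obtain x where x: "x \<in> F" "v = w x" using v by blast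
          then have "w e = w x" using w_eqI[of v e] e(1) w(1)[of x] F(1) by auto
          then show ?thesis using FW[OF x(1)] eE by blast
        qed
        then show "v' \<in> b ` F \<union> w ` F"
          using v' e(2) b_eqI[of v' e] w_eqI[of v' e] by blast
      qed
      then have V1: "?V1 \<subseteq> b ` F"
        using vertices_disjoint F(1) w(1) by blast
      have "?E \<subseteq> F"
      proof
        fix e assume e: "e \<in> ?E"
        then obtain x where x: "x \<in> F" "b e = b x" using V1 b(1) by blast
        then show "e \<in> F" using FB[OF x(1)] e by blast
      qed
      then show ?thesis using F(1) by blast
    qed
  qed (rule that)
  define v where "v = b e"
  have v: "v \<in> ?V1 \<union> ?V2" using b(1)[OF e(1)] by (simp add: v_def)
  have at_v: "?at v = {e' \<in> ?E. b e' = b e}" using at_b[OF e(1)] by (simp add: v_def)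
  have fixed: "\<tau> x = x" if "x \<in> ?at v" for x using e(3) that at_v by blast
  have "e \<in> ?at v" using b(2)[OF e(1)] by (simp add: v_def)
  then have "\<sigma> v = v" using b\<tau>[OF e(1)] fixed[of e] by (simp add: v_def)
  then have fv: "f v = cnj v" by (metis \<sigma>_def complex_cnj_cnj)
  have gx: "g x = cnj ` x" if "x \<in> ?at v" for x
    using fixed[OF that] cnj_im[of "g x"] by (simp add: \<tau>_def)
  have "finite (?at v - {e})" using finite_edges_at[OF v] by simp
  have card_v: "card (?at v) = 3" using e(2) at_v by simp
  then have card2: "card (?at v - {e}) = 2" using \<open>e \<in> ?at v\<close> by simp
  then have "?at v - {e} \<noteq> {}" by (metis card.empty zero_neq_numeral)
  define x where "x = arg_min_on (ccw_angle v e) (?at v - {e})"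
  have x: "x \<in> ?at v - {e}" "\<And>y. y \<in> ?at v - {e} \<Longrightarrow> ccw_angle v e x \<le> ccw_angle v e y"
    unfolding x_def
    using arg_min_if_finite(1)[OF \<open>finite (?at v - {e})\<close> \<open>?at v - {e} \<noteq> {}\<close>]
      arg_min_least[OF \<open>finite (?at v - {e})\<close> \<open>?at v - {e} \<noteq> {}\<close>] by auto
  \<comment> \<open>Degree 3 leaves an edge besides \<open>e\<close> and its successor
    \<open>x\<close>. Conjugation turns an angle \<theta> into 2 pi - \<theta>, so \<open>x\<close>
    would have both the least and the greatest angle from \<open>e\<close>, and \<open>y\<close>
    would tie with it.\<close>
  obtain y where y: "y \<in> ?at v - {e}" "y \<noteq> x"
  proof -
    have "card (?at v - {e} - {x}) = 1" using card2 x(1) by simp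
    then show ?thesis using that by (metis card_1_singletonE DiffE insertI1 singletonI)
  qed
  have "?at v \<noteq> {e}" using x(1) by blast
  then have "ccw_next P c1 c2 v e x"
    using x \<open>e \<in> ?at v\<close> by (simp add: ccw_next_def)
  then have next': "ccw_next ?Q (cnj c1) (cnj c2) (cnj v) (cnj ` e) (cnj ` x)"
    using fg v e(1) x(1) edges_atD \<open>e \<in> ?at v\<close> fv gx by (metis DiffD1)
  have ne': "edges_at ?Q (cnj c1) (cnj c2) (cnj v) \<noteq> {cnj ` e}"
  proof
    assume "edges_at ?Q (cnj c1) (cnj c2) (cnj v) = {cnj ` e}"
    moreover have "cnj ` x \<in> edges_at ?Q (cnj c1) (cnj c2) (cnj v)"
      using x(1) unfolding edges_at_iff by blast
    ultimately have "cnj ` x = cnj ` e" by blast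
    then have "x = e" by (rule iffD1[OF inj_image_transport])
    then show False using x(1) by blast
  qed
  have "cnj ` y \<in> edges_at ?Q (cnj c1) (cnj c2) (cnj v) - {cnj ` e}"
    using y(1) by (auto simp: edges_at_iff inj_image_transport)
  then have le': "ccw_angle (cnj v) (cnj ` e) (cnj ` x) \<le> ccw_angle (cnj v) (cnj ` e) (cnj ` y)"
    using next' ne' by (simp add: ccw_next_def)
  have mirror: "ccw_angle (cnj v) (cnj ` e) (cnj ` z) = 2 * pi - ccw_angle v e z" if "z \<in> ?at v - {e}" for z
  proof -
    have "Arg2pi (edge_direction v z / edge_direction v e) \<noteq> 0"
      using ccw_angle_nonzero[OF v \<open>e \<in> ?at v\<close>, of z] that by (simp add: ccw_angle_def)
    then have "Arg2pi (cnj (edge_direction v z / edge_direction v e))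
        = 2 * pi - Arg2pi (edge_direction v z / edge_direction v e)"
      by (rule Arg2pi_cnj_nonzero)
    then show ?thesis
      using direction[OF v] that \<open>e \<in> ?at v\<close> by (simp add: ccw_angle_def)
  qed
  have "ccw_angle v e x = ccw_angle v e y"
    using le' mirror[OF x(1)] mirror[OF y(1)] x(2)[OF y(1)] by simp
  then show False
    using ccw_angle_inj[OF v \<open>e \<in> ?at v\<close>, of x y] x(1) y by blast
qed

subsection \<open>The two polynomials\<close>

text \<open>The derivative of \<open>shabat9 \<alpha>\<close> is \<open>9 q (x\<^sup>2 + s)\<^sup>2\<close> with \<open>s\<close> the following number. The
  critical value \<open>c \<alpha>\<close> of the theorem is the value at the two roots of \<open>x\<^sup>2 + s\<close>.\<close>

definition crit_shift :: "complex \<Rightarrow> complex" where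
  "crit_shift \<alpha> = (10 * \<alpha> - 27) / 49"

definition crit_value :: "complex \<Rightarrow> complex" where
  "crit_value \<alpha> = (28884992 + 4079616 * \<alpha>) / 40353607"

definition quartic9 :: "complex \<Rightarrow> complex poly" where
  "quartic9 \<alpha> = [: - 59/2401 - 156 * \<alpha> / 2401, - 40/49 + 48 * \<alpha> / 49, 6/7 * (- 5/7 + 6 * \<alpha> / 7), 8/7, 1 :]"

lemma shabat9_eq: "shabat9 \<alpha> = [:-1, 1:] * quartic9 \<alpha> ^ 2"
  by (simp add: shabat9_def quartic9_def)

lemma square_minus_3_iff: "\<alpha> ^ 2 = -3 \<longleftrightarrow> \<alpha> \<in> {\<i> * sqrt 3, - \<i> * sqrt 3}"
proof -
  have "(\<i> * complex_of_real (sqrt 3)) ^ 2 = -3"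
    by (simp add: power_mult_distrib flip: of_real_power)
  then have "\<alpha> ^ 2 = -3 \<longleftrightarrow> \<alpha> ^ 2 = (\<i> * complex_of_real (sqrt 3)) ^ 2" by simp
  then show ?thesis unfolding power2_eq_iff by simp
qed

lemma pderiv_mult_square:
  fixes p q :: "'a::idom poly"
  shows "pderiv (p * q ^ 2) = q * (pderiv p * q + 2 * p * pderiv q)"
  by (simp add: pderiv_mult power2_eq_square algebra_simps)

lemma order_linear_factor: "order z [:- a, 1 :: 'a::idom:] = (if z = a then 1 else 0)"
proof (cases "z = a")
  case True
  then show ?thesis using order_power_n_n[of a 1] by simp
next
  case False
  then show ?thesis by (simp add: order_0I)
qed

lemma order_square: "p \<noteq> 0 \<Longrightarrow> order z (p ^ 2) = 2 * order z (p :: 'a::idom poly)"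
  by (simp add: power2_eq_square order_mult)

lemma degree_shabat9: "degree (shabat9 \<alpha>) = 9"
proof -
  have "quartic9 \<alpha> \<noteq> 0" "degree (quartic9 \<alpha>) = 4" by (auto simp: quartic9_def)
  then show ?thesis unfolding shabat9_eq by (subst degree_mult_eq) (auto simp: degree_power_eq)
qed

context
  fixes \<alpha> :: complex
  assumes \<alpha>: "\<alpha> ^ 2 = -3"
begin

text \<open>As rewrite rules these reduce polynomials in \<alpha> to degree at most 1; the second
  form acts inside products nested to the right.\<close>

lemma square_minus_3_mult: "\<alpha> * \<alpha> = -3" "\<alpha> * (\<alpha> * x) = -3 * x"
  using \<alpha> by (simp_all add: power2_eq_square flip: mult.assoc)

text \<open>A rational \<alpha> would have a nonnegative square. This decides that the explicit
  constants do not vanish.\<close>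

lemma square_minus_3_not_rational:
  assumes "of_rat a + of_rat b * \<alpha> = 0" "b \<noteq> 0"
  shows False
proof -
  have "\<alpha> = of_rat (- a / b)"
    using assms by (simp add: of_rat_divide of_rat_minus field_simps eq_neg_iff_add_eq_0)
  then have "of_rat ((- a / b) ^ 2) = (of_rat (-3) :: complex)"
    using \<alpha> by (simp only: of_rat_power) simp
  then have "(- a / b) ^ 2 = -3" by (simp only: of_rat_eq_iff)
  then show False using zero_le_power2[of "- a / b"] by linarith
qed

lemma crit_shift_nonzero: "crit_shift \<alpha> \<noteq> 0"
  using square_minus_3_not_rational[of "-27" 10] by (auto simp: crit_shift_def algebra_simps)

lemma one_plus_crit_shift_nonzero: "1 + crit_shift \<alpha> \<noteq> 0"
  using square_minus_3_not_rational[of 22 10] by (auto simp: crit_shift_def field_simps)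

lemma crit_value_nonzero: "crit_value \<alpha> \<noteq> 0"
  using square_minus_3_not_rational[of 28884992 4079616] by (auto simp: crit_value_def algebra_simps)

lemma quartic9_ode:
  "quartic9 \<alpha> + 2 * [:-1, 1:] * pderiv (quartic9 \<alpha>) = 9 * [:crit_shift \<alpha>, 0, 1:] ^ 2"
  by (simp add: quartic9_def crit_shift_def pderiv_pCons power2_eq_square numeral_poly)
     (simp add: field_simps square_minus_3_mult)

lemma pderiv_shabat9:
  "pderiv (shabat9 \<alpha>) = 9 * (quartic9 \<alpha> * [:crit_shift \<alpha>, 0, 1:] ^ 2)"
proof -
  have "pderiv (shabat9 \<alpha>) = quartic9 \<alpha> * (quartic9 \<alpha> + 2 * [:-1, 1:] * pderiv (quartic9 \<alpha>))"
    unfolding shabat9_eq pderiv_mult_square by (simp add: pderiv_pCons)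
  then show ?thesis unfolding quartic9_ode by (simp only: mult.left_commute)
qed

text \<open>Since r^2 = -s, the quartic at r reduces to E + r D with \<open>E\<close> and
  \<open>D\<close> independent of the choice of root. In (r - 1) (E + r D)^2 the part odd in r
  vanishes, so both roots give the same value.\<close>

lemma shabat9_at_crit:
  assumes r: "r ^ 2 = - crit_shift \<alpha>"
  shows "poly (shabat9 \<alpha>) r = crit_value \<alpha>"
proof -
  let ?s = "crit_shift \<alpha>"
  define E where "E = (640 + 576 * \<alpha>) / 2401"
  define D where "D = (256 * \<alpha> - 64) / 343"
  have "poly (quartic9 \<alpha>) r = (r^2)^2 + 8/7 * (r * r^2) + 6/7 * (- 5/7 + 6 * \<alpha> / 7) * r^2
      + (- 40/49 + 48 * \<alpha> / 49) * r + (- 59/2401 - 156 * \<alpha> / 2401)"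
    by (simp add: quartic9_def algebra_simps power2_eq_square)
  also have "\<dots> = E + r * D"
    unfolding r by (simp add: E_def D_def crit_shift_def power2_eq_square field_simps square_minus_3_mult)
  finally have q: "poly (quartic9 \<alpha>) r = E + r * D" .
  have odd: "E ^ 2 - ?s * D ^ 2 - 2 * E * D = 0"
    by (simp add: E_def D_def crit_shift_def power2_eq_square field_simps square_minus_3_mult)
  have even: "?s * D ^ 2 - E ^ 2 - 2 * ?s * E * D = crit_value \<alpha>"
    by (simp add: E_def D_def crit_shift_def crit_value_def power2_eq_square field_simps square_minus_3_mult)
  have "(r - 1) * (E + r * D) ^ 2 = r * (E ^ 2 + r^2 * D ^ 2 - 2 * E * D) + (2 * r^2 * E * D - E ^ 2 - r^2 * D ^ 2)"
    by (simp add: power2_eq_square algebra_simps)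
  also have "\<dots> = r * (E ^ 2 - ?s * D ^ 2 - 2 * E * D) + (?s * D ^ 2 - E ^ 2 - 2 * ?s * E * D)"
    unfolding r by (simp add: algebra_simps)
  finally have "(r - 1) * (E + r * D) ^ 2 = crit_value \<alpha>"
    unfolding odd even by simp
  then show ?thesis by (simp add: shabat9_eq q left_diff_distrib)
qed

lemma shabat_shabat9: "shabat (shabat9 \<alpha>) (crit_value \<alpha>) 0"
  unfolding shabat_def
proof (intro conjI allI impI)
  show "crit_value \<alpha> \<noteq> 0" by (rule crit_value_nonzero)
  fix z assume "poly (pderiv (shabat9 \<alpha>)) z = 0"
  then have "9 * (poly (quartic9 \<alpha>) z * poly [:crit_shift \<alpha>, 0, 1:] z ^ 2) = 0"
    unfolding pderiv_shabat9 by (simp only: poly_mult poly_power poly_numeral)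
  then have "poly (quartic9 \<alpha>) z = 0 \<or> crit_shift \<alpha> + z ^ 2 = 0"
    by (simp add: power2_eq_square del: mult_eq_0_iff)
  then consider "poly (quartic9 \<alpha>) z = 0" | "z ^ 2 = - crit_shift \<alpha>"
    using minus_unique by metis
  then show "poly (shabat9 \<alpha>) z \<in> {crit_value \<alpha>, 0}"
    by cases (auto simp: shabat9_at_crit, simp add: shabat9_eq)
qed (simp add: degree_shabat9)

text \<open>The order of P - P(z) at z is one more than that of the derivative, which is factored
  explicitly. The number of remaining vertices in each fibre then follows from the total degree
  9.\<close>

lemma has_passport_shabat9:
  "has_passport (shabat9 \<alpha>) (crit_value \<alpha>) 0 {#3, 3, 1, 1, 1#} {#2, 2, 2, 2, 1#} 9"
proof -
  let ?P = "shabat9 \<alpha>" and ?q = "quartic9 \<alpha>" and ?s = "crit_shift \<alpha>" and ?c = "crit_value \<alpha>"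
  define r where "r = csqrt (- ?s)"
  have r2: "r ^ 2 = - ?s" by (simp add: r_def)
  then have "r \<noteq> 0" using crit_shift_nonzero by auto
  then have rr: "r \<noteq> - r" by simp
  have S: "[:?s, 0, 1:] = [:-r, 1:] * [:- (- r), 1:]"
    using r2 by (simp add: power2_eq_square)
  have degP: "degree ?P > 0" by (simp add: degree_shabat9)
  have P': "pderiv ?P \<noteq> 0" using degP by (auto simp: pderiv_eq_0_iff)
  have q0: "?q \<noteq> 0" by (simp add: quartic9_def)
  have ordS: "order z [:?s, 0, 1:] = (if z = r \<or> z = - r then 1 else 0)" for z
    unfolding S using order_linear_factor[of z r] order_linear_factor[of z "- r"] rr
    by (subst order_mult) (simp_all del: mult_pCons_left)
  have ordP': "order z (pderiv ?P) = order z ?q + 2 * order z [:?s, 0, 1:]" for z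
  proof -
    have "pderiv ?P = smult 9 (?q * [:?s, 0, 1:] ^ 2)"
      by (simp add: pderiv_shabat9 numeral_poly)
    then show ?thesis using P' by (simp add: order_smult order_mult order_square)
  qed
  have ordP: "order z (?P - [:poly ?P z:]) = Suc (order z ?q + 2 * order z [:?s, 0, 1:])" for z
    using order_pderiv[of "?P - [:poly ?P z:]" z] minus_const_nonzero[OF degP, of "poly ?P z"] ordP'[of z] by simp
  have q_nz: "poly ?q z \<noteq> 0" if "poly ?P z = ?c" for z
    using that crit_value_nonzero by (auto simp: shabat9_eq)
  have at_r: "poly ?P r = ?c" "poly ?P (- r) = ?c"
    using shabat9_at_crit r2 by simp_all
  have finP: "finite (tree_vertices ?P c)" for c
    unfolding tree_vertices_def by (rule finite_fibre[OF degP])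
  have sumP: "(\<Sum>z\<in>tree_vertices ?P c. order z (?P - [:c:])) = 9" for c
    using sum_order_eq_degree[OF minus_const_nonzero[OF degP, of c]]
    by (simp add: tree_vertices_def degree_shabat9)
  have ord_c: "order z (?P - [:?c:]) = (if z = r \<or> z = - r then 3 else 1)" if "poly ?P z = ?c" for z
    using ordP[of z] ordS[of z] q_nz[OF that] order_root[of ?q z] that by auto
  define R where "R = tree_vertices ?P ?c - {r, - r}"
  have Vc: "tree_vertices ?P ?c = insert r (insert (- r) R)" and finR: "finite R"
    using at_r finP[of ?c] by (auto simp: R_def tree_vertices_def)
  have notR: "r \<notin> R" "- r \<notin> R" by (auto simp: R_def)
  have ordR: "order z (?P - [:?c:]) = 1" if "z \<in> R" for z
    using that ord_c[of z] by (auto simp: R_def tree_vertices_def)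
  have "3 + (3 + card R) = 9"
    using sumP[of ?c] finR notR rr ordR ord_c[OF at_r(1)] ord_c[OF at_r(2)] by (simp add: Vc)
  then have cardR: "card R = 3" by simp
  have "image_mset (\<lambda>z. order z (?P - [:?c:])) (mset_set R) = image_mset (\<lambda>_. 1) (mset_set R)"
    using ordR finR by (intro image_mset_cong) simp
  then have deg_c: "vertex_degrees ?P ?c = {#3, 3, 1, 1, 1#}"
    unfolding vertex_degrees_def Vc using finR notR rr ord_c[OF at_r(1)] ord_c[OF at_r(2)] cardR
    by (simp add: image_mset_const_eq numeral_3_eq_3)
  \<comment> \<open>At x = 1 the differential equation reads q(1) = 9 (1 + s)^2.\<close>
  have q1: "poly ?q 1 \<noteq> 0"
    using arg_cong[OF quartic9_ode, of "\<lambda>p. poly p 1"] one_plus_crit_shift_nonzero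
    by (auto simp: add.commute)
  define U where "U = tree_vertices ?P 0 - {1}"
  have V0: "tree_vertices ?P 0 = insert 1 U" and finU: "finite U"
    using finP[of 0] by (auto simp: U_def tree_vertices_def shabat9_eq)
  have notU: "1 \<notin> U" by (simp add: U_def)
  have "r ^ 2 \<noteq> 1" using r2 one_plus_crit_shift_nonzero by (metis add.commute minus_minus neg_eq_iff_add_eq_0)
  then have S1: "1 \<noteq> r" "1 \<noteq> - r" by (metis one_power2, metis one_power2 power2_minus)
  have ord1: "order 1 (?P - [:0:]) = 1"
    using ordP[of 1] ordS[of 1] S1 order_root[of ?q 1] q1 by (simp add: shabat9_eq)
  \<comment> \<open>The derivative gives order 1 + n and the factorization gives 2 n, where n is the
    order of the quartic at z; hence n = 1. So the roots of the quartic are simple without a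
    discriminant being computed.\<close>
  have ordU: "order z (?P - [:0:]) = 2" if "z \<in> U" for z
  proof -
    have z: "poly ?P z = 0" "z \<noteq> 1" using that by (auto simp: U_def tree_vertices_def)
    then have "z \<noteq> r" "z \<noteq> - r" using at_r crit_value_nonzero by auto
    then have "order z ?P = Suc (order z ?q)" using ordP[of z] ordS[of z] z by simp
    moreover have "order z ?P = order z [:-1, 1:] + 2 * order z ?q"
      using degP unfolding shabat9_eq by (subst order_mult) (auto simp: order_square q0)
    moreover have "order z [:-1, 1:] = 0" using z(2) by (intro order_0I) simp
    ultimately show ?thesis by simp
  qed
  have "1 + 2 * card U = 9"
    using sumP[of 0] finU notU ordU ord1 by (simp add: V0)
  then have cardU: "card U = 4" by simp
  have "image_mset (\<lambda>z. order z (?P - [:0:])) (mset_set U) = image_mset (\<lambda>_. 2) (mset_set U)"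
    using ordU finU by (intro image_mset_cong) simp
  then have deg_0: "vertex_degrees ?P 0 = {#2, 2, 2, 2, 1#}"
    unfolding vertex_degrees_def V0 using finU notU ord1 cardU
    by (simp add: image_mset_const_eq numeral_eq_Suc)
  show ?thesis
    unfolding has_passport_def using degree_shabat9 deg_c deg_0 by simp
qed

end

section \<open>Classification of the polynomials with this passport\<close>

text \<open>The linear hypotheses are the coefficients of the differential equation with the simple
  root at 1. The two critical values differ by 2 r times the odd part, which after elimination is a
  nonzero rational multiple of s^2 (49 s^2 + 54 s + 21).\<close>

lemma odd_part_condition:
  fixes s r e0 e1 e2 :: complex
  assumes e2: "5 * e2 = 48 / 7 + 18 * s" and e1: "3 * e1 = 4 * e2" and e0: "e0 = 2 * e1 + 9 * s ^ 2"
    and r: "r ^ 2 = - s" "r \<noteq> 0"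
    and eq: "(r - 1) * poly [:e0, e1, e2, 8/7, 1:] r ^ 2 = (- r - 1) * poly [:e0, e1, e2, 8/7, 1:] (- r) ^ 2"
  shows "49 * s ^ 2 + 54 * s + 21 = 0"
proof -
  define E where "E = s ^ 2 - e2 * s + e0"
  define D where "D = e1 - 8/7 * s"
  have q: "poly [:e0, e1, e2, 8/7, 1:] x = E + x * D" if "x ^ 2 = - s" for x
  proof -
    have "poly [:e0, e1, e2, 8/7, 1:] x = e0 + e1 * x + e2 * x^2 + 8/7 * (x * x^2) + (x^2)^2"
      by (simp add: algebra_simps power2_eq_square)
    also have "\<dots> = E + x * D"
      unfolding that by (simp add: E_def D_def algebra_simps)
    finally show ?thesis .
  qed
  have "(r - 1) * (E + r * D) ^ 2 = (- r - 1) * (E + (- r) * D) ^ 2"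
    using eq q[of r] q[of "- r"] r(1) by simp
  then have "2 * r * (E ^ 2 + r ^ 2 * D ^ 2 - 2 * E * D) = 0"
    by (simp add: power2_eq_square algebra_simps)
  then have odd: "E ^ 2 - s * D ^ 2 - 2 * E * D = 0"
    using r by simp
  have e2': "e2 = 48 / 35 + 18 / 5 * s" using e2 by (simp add: field_simps)
  have "e1 = 4 / 3 * e2" using e1 by (simp add: field_simps)
  also have "\<dots> = 64 / 35 + 24 / 5 * s" by (simp add: e2' field_simps)
  finally have e1': "e1 = 64 / 35 + 24 / 5 * s" .
  have "E ^ 2 - s * D ^ 2 - 2 * E * D = 1024 / 1225 * (s ^ 2 * (49 * s ^ 2 + 54 * s + 21))"
    unfolding E_def D_def e0 e1' e2' by (simp add: power2_eq_square field_simps)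
  moreover have "s \<noteq> 0" using r by auto
  ultimately show ?thesis using odd by simp
qed

text \<open>Each fibre supplies a factorization: the one over \<open>d2\<close> of
  \<open>Q - [:d2:]\<close>, and both together of the derivative. An affine change of variable then
  leaves the single parameter \<open>s\<close>.\<close>

lemma shabat9_classification:
  assumes Q: "shabat Q d1 d2" and pp: "has_passport Q d1 d2 {#3, 3, 1, 1, 1#} {#2, 2, 2, 2, 1#} 9"
  obtains \<alpha> where "\<alpha> ^ 2 = -3" "shabat_equiv (shabat9 \<alpha>) (crit_value \<alpha>) 0 Q d1 d2"
proof -
  interpret shabat_tree Q d1 d2 by unfold_locales (rule Q)
  let ?V1 = "tree_vertices Q d1" and ?V2 = "tree_vertices Q d2"
  let ?H = "Q - [:d2:]"
  have deg: "degree Q = 9" and deg1: "vertex_degrees Q d1 = {#3, 3, 1, 1, 1#}"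
    and deg2: "vertex_degrees Q d2 = {#2, 2, 2, 2, 1#}"
    using pp by (auto simp: has_passport_def)
  have "card {v \<in> ?V1. order v (Q - [:d1:]) = 3} = 2"
    by (simp add: card_vertices_of_order[OF degree_pos] deg1)
  then obtain u u' where u: "{v \<in> ?V1. order v (Q - [:d1:]) = 3} = {u, u'}" "u \<noteq> u'"
    by (meson card_2_iff)
  have "card {v \<in> ?V2. order v ?H = 1} = 1"
    by (simp add: card_vertices_of_order[OF degree_pos] deg2)
  then obtain a where a: "{v \<in> ?V2. order v ?H = 1} = {a}"
    by (meson card_1_singletonE)
  define W where "W = {v \<in> ?V2. order v ?H = 2}"
  have cardW: "card W = 4"
    by (simp add: W_def card_vertices_of_order[OF degree_pos] deg2)
  have finW: "finite W" using finite_vertices by (simp add: W_def)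
  have ord1: "order v (Q - [:d1:]) \<in> {1, 3}" if "v \<in> ?V1" for v
    using order_in_vertex_degrees[OF degree_pos that] by (auto simp: deg1)
  have ord2: "order v ?H \<in> {1, 2}" if "v \<in> ?V2" for v
    using order_in_vertex_degrees[OF degree_pos that] by (auto simp: deg2)
  have aV: "a \<in> ?V2" "order a ?H = 1" using a by auto
  have V2: "?V2 = insert a W" using ord2 a by (auto simp: W_def)
  have aW: "a \<notin> W" using aV by (simp add: W_def)
  have uV: "u \<in> ?V1" "u' \<in> ?V1" "order u (Q - [:d1:]) = 3" "order u' (Q - [:d1:]) = 3"
    using u(1) by auto
  have uW: "u \<notin> W" "u' \<notin> W" using uV vertices_disjoint by (auto simp: W_def)
  define q where "q = (\<Prod>z\<in>W. [:- z, 1:])"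
  define k where "k = lead_coeff ?H"
  have H0: "?H \<noteq> 0" by (rule minus_const_nonzero[OF degree_pos])
  then have k0: "k \<noteq> 0" unfolding k_def by (rule leading_coeff_neq_0)
  have q0: "q \<noteq> 0" using finW by (simp add: q_def)
  have degq: "degree q = 4"
    unfolding q_def by (subst degree_prod_sum_eq) (use cardW in auto)
  have leadq: "lead_coeff q = 1" by (simp add: q_def lead_coeff_prod)
  have H_eq: "?H = smult k ([:- a, 1:] * q ^ 2)"
  proof -
    have "{z. poly ?H z = 0} = insert a W" using V2 by (simp add: tree_vertices_def)
    then have "?H = smult k (\<Prod>z\<in>insert a W. [:- z, 1:] ^ order z ?H)"
      using complex_poly_decompose[of ?H] by (simp add: k_def)
    also have "(\<Prod>z\<in>insert a W. [:- z, 1:] ^ order z ?H) = [:- a, 1:] * (\<Prod>z\<in>W. [:- z, 1:] ^ order z ?H)"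
      using finW aW aV(2) by simp
    also have "(\<Prod>z\<in>W. [:- z, 1:] ^ order z ?H) = (\<Prod>z\<in>W. [:- z, 1:] ^ 2)"
      by (rule prod.cong) (auto simp: W_def)
    also have "\<dots> = q ^ 2" by (simp add: q_def prod_power_distrib)
    finally show ?thesis .
  qed
  let ?S = "[:- u, 1:] * [:- u', 1:]"
  have Q'0: "pderiv Q \<noteq> 0" using degree_pos by (auto simp: pderiv_eq_0_iff)
  have ordQ': "order z (Q - [:poly Q z:]) = Suc (order z (pderiv Q))" for z
    using order_pderiv[of "Q - [:poly Q z:]" z] minus_const_nonzero[OF degree_pos] by simp
  have ordu: "order u (pderiv Q) = 2" "order u' (pderiv Q) = 2"
    using ordQ'[of u] ordQ'[of u'] uV by (auto simp: tree_vertices_def)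
  have ordW: "order z (pderiv Q) = 1" if "z \<in> W" for z
    using ordQ'[of z] that by (auto simp: W_def tree_vertices_def)
  \<comment> \<open>Critical points are the vertices of degree above 1: the two of degree 3 and the
    four of degree 2.\<close>
  have rootsQ': "{z. poly (pderiv Q) z = 0} = insert u (insert u' W)"
  proof (intro equalityI subsetI)
    fix z assume "z \<in> {z. poly (pderiv Q) z = 0}"
    then have z: "order z (pderiv Q) \<noteq> 0" "poly Q z = d1 \<or> poly Q z = d2"
      using order_root[of "pderiv Q" z] Q'0 noncritical[of z] by auto
    from z(2) show "z \<in> insert u (insert u' W)"
    proof
      assume "poly Q z = d1"
      then have "z \<in> {v \<in> ?V1. order v (Q - [:d1:]) = 3}"
        using ord1[of z] z(1) ordQ'[of z] by (auto simp: tree_vertices_def)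
      then show ?thesis using u(1) by blast
    next
      assume "poly Q z = d2"
      then have "z \<in> W"
        using ord2[of z] z(1) ordQ'[of z] by (auto simp: tree_vertices_def W_def)
      then show ?thesis by blast
    qed
  next
    fix z assume "z \<in> insert u (insert u' W)"
    then have "order z (pderiv Q) \<noteq> 0" using ordu ordW by auto
    then show "z \<in> {z. poly (pderiv Q) z = 0}" using order_root by auto
  qed
  have lead: "lead_coeff (pderiv Q) = 9 * k"
  proof -
    have "coeff ?H 9 = k" using deg by (simp add: k_def)
    moreover have "coeff ?H 9 = coeff Q 9" by (simp add: coeff_pCons split: nat.split)
    ultimately show ?thesis using deg by (simp add: degree_pderiv coeff_pderiv)
  qed
  have Q'_eq: "pderiv Q = smult (9 * k) (?S ^ 2 * q)"
  proof -
    have "pderiv Q = smult (9 * k) (\<Prod>z\<in>insert u (insert u' W). [:- z, 1:] ^ order z (pderiv Q))"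
      using complex_poly_decompose[of "pderiv Q"] unfolding rootsQ' lead by simp
    also have "(\<Prod>z\<in>insert u (insert u' W). [:- z, 1:] ^ order z (pderiv Q))
        = [:- u, 1:] ^ 2 * ([:- u', 1:] ^ 2 * (\<Prod>z\<in>W. [:- z, 1:] ^ order z (pderiv Q)))"
      using finW uW u(2) ordu by simp
    also have "(\<Prod>z\<in>W. [:- z, 1:] ^ order z (pderiv Q)) = q"
      unfolding q_def by (rule prod.cong) (simp_all add: ordW)
    finally show ?thesis by (simp only: power_mult_distrib mult.assoc)
  qed
  have ode: "q + 2 * [:- a, 1:] * pderiv q = 9 * ?S ^ 2"
  proof -
    have "pderiv ?H = smult k (q * (q + 2 * [:- a, 1:] * pderiv q))"
      unfolding H_eq pderiv_smult pderiv_mult_square by (simp add: pderiv_pCons)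
    then have "smult k (q * (q + 2 * [:- a, 1:] * pderiv q)) = smult k (q * (9 * ?S ^ 2))"
      using Q'_eq by (simp add: numeral_poly mult.commute)
    then show ?thesis
      using k0 q0 by (metis mult_left_cancel smult_cancel)
  qed
  \<comment> \<open>In the coordinate y with x = m + h y, the vertices of degree 3 lie at
    \<open>r\<close> and \<open>- r\<close>, and the simple root \<open>a\<close> lies at
    \<open>t\<close>.\<close>
  define m where "m = (u + u') / 2"
  define \<delta> where "\<delta> = (u - u') / 2"
  \<comment> \<open>If \<open>a\<close> is the midpoint it determines no scale. Taking 1 then gives
    t = 0, and otherwise t = 1, so one computation covers both until t = 0 is excluded.\<close>
  define h where "h = (if a = m then 1 else a - m)"
  define t where "t = (a - m) / h"
  define r where "r = \<delta> / h"
  define s where "s = - (r ^ 2)"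
  have h0: "h \<noteq> 0" by (simp add: h_def)
  have t01: "t = 0 \<or> t = 1" by (auto simp: t_def h_def)
  have r0: "r \<noteq> 0" using u(2) h0 by (simp add: r_def \<delta>_def)
  have um: "u = m + h * r" "u' = m + h * (- r)" and am: "a = m + h * t"
    using h0 by (simp_all add: m_def \<delta>_def r_def t_def field_simps)
  define p where "p = pcompose q [:m, h:]"
  have degp: "degree p = 4" using h0 by (simp add: p_def degree_pcompose degq)
  have "lead_coeff p = h ^ 4"
    unfolding p_def using h0 leadq degq by (subst lead_coeff_comp) auto
  then have p4: "coeff p 4 = h ^ 4" by (simp add: degp)
  define e where "e i = coeff p i / h ^ 4" for i
  let ?q = "[:e 0, e 1, e 2, e 3, 1:]"
  have p_eq: "p = smult (h ^ 4) ?q"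
  proof (rule poly_eqI)
    fix n
    show "coeff p n = coeff (smult (h ^ 4) ?q) n"
    proof (cases "n \<le> 4")
      case True
      then have "n = 0 \<or> n = 1 \<or> n = 2 \<or> n = 3 \<or> n = 4" by auto
      then show ?thesis using h0 p4 by (auto simp: e_def numeral_eq_Suc)
    next
      case False
      then have "coeff p n = 0" "degree (smult (h ^ 4) ?q) < n" using degp h0 by (auto intro: coeff_eq_0)
      then show ?thesis by (metis coeff_eq_0)
    qed
  qed
  have q_at: "poly q (m + h * y) = h ^ 4 * poly ?q y" for y
  proof -
    have "poly p y = poly q (m + h * y)" by (simp add: p_def poly_pcompose mult.commute)
    then show ?thesis by (simp only: p_eq poly_smult)
  qed
  have q'_at: "h * poly (pderiv q) (m + h * y) = h ^ 4 * poly (pderiv ?q) y" for y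
  proof -
    have "poly (pderiv p) y = h * poly (pderiv q) (m + h * y)"
      by (simp add: p_def pderiv_pcompose poly_pcompose pderiv_pCons mult.commute)
    then show ?thesis by (simp only: p_eq pderiv_smult poly_smult)
  qed
  have ode': "?q + 2 * [:- t, 1:] * pderiv ?q = 9 * [:s, 0, 1:] ^ 2"
  proof (rule poly_eq_poly_eq_iff[THEN iffD1], rule ext)
    fix y
    have "poly q x + 2 * (x - a) * poly (pderiv q) x = 9 * ((x - u) * (x - u')) ^ 2" for x
    proof -
      have "poly (q + 2 * [:- a, 1:] * pderiv q) x = poly (9 * ?S ^ 2) x"
        by (simp only: ode)
      then show ?thesis
        by (simp only: poly_add poly_mult poly_power poly_numeral poly_pCons poly_0) (simp add: algebra_simps)
    qed
    from this[of "m + h * y"] have "poly q (m + h * y) + 2 * (y - t) * (h * poly (pderiv q) (m + h * y))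
        = 9 * ((h * (y - r)) * (h * (y + r))) ^ 2"
      by (simp add: um am right_diff_distrib distrib_left mult_ac)
    then have "h ^ 4 * (poly ?q y + 2 * (y - t) * poly (pderiv ?q) y) = h ^ 4 * (9 * (s + y ^ 2) ^ 2)"
      unfolding q_at q'_at by (simp add: s_def power2_eq_square power4_eq_xxxx algebra_simps)
    then have "poly ?q y + 2 * (y - t) * poly (pderiv ?q) y = 9 * (s + y ^ 2) ^ 2"
      using h0 by simp
    then show "poly (?q + 2 * [:- t, 1:] * pderiv ?q) y = poly (9 * [:s, 0, 1:] ^ 2) y"
      by (simp only: poly_add poly_mult poly_power poly_numeral poly_pCons poly_0)
         (simp add: power2_eq_square algebra_simps)
  qed
  \<comment> \<open>Comparison of the coefficients of degree 3, 2, 1 and 0: each unknown is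
    determined by the higher ones.\<close>
  have e3: "7 * e 3 = 8 * t" and e2: "5 * e 2 = 6 * t * e 3 + 18 * s"
    and e1: "3 * e 1 = 4 * t * e 2" and e0: "e 0 = 2 * t * e 1 + 9 * s ^ 2"
    using ode' by (simp_all add: pderiv_pCons numeral_poly power2_eq_square) (simp_all add: algebra_simps)
  have Q_at: "poly Q (m + h * y) = k * h ^ 9 * ((y - t) * poly ?q y ^ 2) + d2" for y
  proof -
    have "poly Q (m + h * y) - d2 = k * ((m + h * y - a) * poly q (m + h * y) ^ 2)"
      using arg_cong[OF H_eq, of "\<lambda>p. poly p (m + h * y)"] by (simp add: algebra_simps)
    also have "\<dots> = k * h ^ 9 * ((y - t) * poly ?q y ^ 2)"
      unfolding q_at am by (simp add: power_mult_distrib algebra_simps eval_nat_numeral)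
    finally show ?thesis by (simp add: algebra_simps)
  qed
  have Qu: "poly Q u = d1" "poly Q u' = d1" using uV by (simp_all add: tree_vertices_def)
  have kh: "k * h ^ 9 \<noteq> 0" using k0 h0 by simp
  have crit: "k * h ^ 9 * ((r - t) * poly ?q r ^ 2) = d1 - d2"
      "k * h ^ 9 * ((- r - t) * poly ?q (- r) ^ 2) = d1 - d2"
    using Qu Q_at[of r] Q_at[of "- r"] um by (simp_all only: ) (simp_all add: algebra_simps)
  then have eq: "(r - t) * poly ?q r ^ 2 = (- r - t) * poly ?q (- r) ^ 2"
    using kh by (metis mult_left_cancel)
  \<comment> \<open>For t = 0 the quartic is even, so the value at -r is the negative of that at r.
    Equality forces the quartic to vanish at r, and then \<open>d1 = d2\<close>.\<close>
  have "t = 1"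
  proof (rule ccontr)
    assume "t \<noteq> 1"
    then have t0: "t = 0" using t01 by simp
    then have "poly ?q (- r) = poly ?q r" using e3 e1 by simp
    then have "2 * r * poly ?q r ^ 2 = 0" using eq t0 by simp
    then have "poly ?q r = 0" using r0 by simp
    then show False using crit(1) colors_distinct by simp
  qed
  \<comment> \<open>This solves \<open>s = crit_shift \<alpha>\<close> for \<alpha>. Completing the
    square in 49 s^2 + 54 s + 21 = 0 gives (49 s + 27)^2 = -300.\<close>
  define \<alpha> where "\<alpha> = (49 * s + 27) / 10"
  have e3': "e 3 = 8 / 7" using e3 \<open>t = 1\<close> by (simp add: field_simps)
  have "49 * s ^ 2 + 54 * s + 21 = 0"
  proof (rule odd_part_condition)
    show "5 * e 2 = 48 / 7 + 18 * s" using e2 e3' \<open>t = 1\<close> by simp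
    show "3 * e 1 = 4 * e 2" "e 0 = 2 * e 1 + 9 * s ^ 2" using e1 e0 \<open>t = 1\<close> by simp_all
    show "r ^ 2 = - s" by (simp add: s_def)
    show "(r - 1) * poly [:e 0, e 1, e 2, 8/7, 1:] r ^ 2 = (- r - 1) * poly [:e 0, e 1, e 2, 8/7, 1:] (- r) ^ 2"
      using eq unfolding e3' \<open>t = 1\<close> .
  qed (rule r0)
  then have \<alpha>: "\<alpha> ^ 2 = -3"
    unfolding \<alpha>_def by (simp add: power2_eq_square field_simps) algebra
  have "10 * \<alpha> = 49 * s + 27" by (simp add: \<alpha>_def)
  then have s: "s = crit_shift \<alpha>" by (simp add: crit_shift_def)
  have "?q = quartic9 \<alpha>"
  proof -
    have "e 2 = (48 / 7 + 18 * s) / 5"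
      using e2 e3' \<open>t = 1\<close> by (simp add: field_simps)
    also have "\<dots> = 6/7 * (- 5/7 + 6 * \<alpha> / 7)"
      unfolding s crit_shift_def by (simp add: field_simps)
    finally have 2: "e 2 = 6/7 * (- 5/7 + 6 * \<alpha> / 7)" .
    have "e 1 = 4 / 3 * e 2" using e1 \<open>t = 1\<close> by (simp add: field_simps)
    also have "\<dots> = - 40/49 + 48 * \<alpha> / 49"
      unfolding 2 by (simp add: field_simps)
    finally have 1: "e 1 = - 40/49 + 48 * \<alpha> / 49" .
    have "e 0 = 2 * e 1 + 9 * s ^ 2" using e0 \<open>t = 1\<close> by simp
    also have "\<dots> = - 59/2401 - 156 * \<alpha> / 2401"
      unfolding 1 s crit_shift_def by (simp add: power2_eq_square field_simps square_minus_3_mult[OF \<alpha>])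
    finally have 0: "e 0 = - 59/2401 - 156 * \<alpha> / 2401" .
    show ?thesis by (simp only: quartic9_def 0 1 2 e3')
  qed
  then have Q_at': "poly Q (m + h * y) = k * h ^ 9 * poly (shabat9 \<alpha>) y + d2" for y
    using Q_at[of y] \<open>t = 1\<close> by (simp add: shabat9_eq algebra_simps)
  have "shabat_equiv (shabat9 \<alpha>) (crit_value \<alpha>) 0 Q d1 d2"
    unfolding shabat_equiv_def
  proof (intro exI conjI allI)
    show "poly Q x = k * h ^ 9 * poly (shabat9 \<alpha>) (1 / h * x + (- m / h)) + d2" for x
      using Q_at'[of "1 / h * x + (- m / h)"] h0 by (simp add: field_simps)
    show "d1 = k * h ^ 9 * crit_value \<alpha> + d2"
    proof -
      have "r ^ 2 = - crit_shift \<alpha>" by (simp add: s_def flip: s)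
      then show ?thesis
        using Q_at'[of r] Qu(1) um(1) shabat9_at_crit[OF \<alpha>] by simp
    qed
  qed (use kh h0 in auto)
  then show ?thesis using that \<alpha> by blast
qed

text \<open>Conjugation negates the purely imaginary \<alpha> and fixes the rational numbers in the
  coefficients.\<close>

lemma shabat9_mirror:
  assumes "\<alpha> ^ 2 = -3"
  shows "map_poly cnj (shabat9 \<alpha>) = shabat9 (- \<alpha>)" "cnj (crit_value \<alpha>) = crit_value (- \<alpha>)"
proof -
  have "\<alpha> = \<i> * sqrt 3 \<or> \<alpha> = - \<i> * sqrt 3"
    using assms unfolding square_minus_3_iff by blast
  then have cnj: "cnj \<alpha> = - \<alpha>" by auto
  then show "cnj (crit_value \<alpha>) = crit_value (- \<alpha>)"
    by (simp add: crit_value_def)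
  have "poly (map_poly cnj (shabat9 \<alpha>)) x = poly (shabat9 (- \<alpha>)) x" for x
    by (simp add: shabat9_def cnj minus_diff_commute)
  then show "map_poly cnj (shabat9 \<alpha>) = shabat9 (- \<alpha>)"
    by (intro poly_eq_poly_eq_iff[THEN iffD1] ext)
qed

theorem lemma9p1:
  shows "\<exists>c :: complex \<Rightarrow> complex.
    (\<forall>\<alpha> \<in> {\<i> * sqrt 3, - \<i> * sqrt 3}.
       shabat (shabat9 \<alpha>) (c \<alpha>) 0 \<and>
       has_passport (shabat9 \<alpha>) (c \<alpha>) 0 {#3, 3, 1, 1, 1#} {#2, 2, 2, 2, 1#} 9) \<and>
    \<not> tree_iso (shabat9 (\<i> * sqrt 3)) (c (\<i> * sqrt 3)) 0
                (shabat9 (- \<i> * sqrt 3)) (c (- \<i> * sqrt 3)) 0 \<and>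
    (\<forall>Q d1 d2.
       shabat Q d1 d2 \<and> has_passport Q d1 d2 {#3, 3, 1, 1, 1#} {#2, 2, 2, 2, 1#} 9 \<longrightarrow>
       (\<exists>\<alpha> \<in> {\<i> * sqrt 3, - \<i> * sqrt 3}. shabat_equiv (shabat9 \<alpha>) (c \<alpha>) 0 Q d1 d2) \<and>
       (\<forall>\<alpha> \<in> {\<i> * sqrt 3, - \<i> * sqrt 3}.
          tree_iso (shabat9 \<alpha>) (c \<alpha>) 0 Q d1 d2 \<longleftrightarrow>
          shabat_equiv (shabat9 \<alpha>) (c \<alpha>) 0 Q d1 d2))"
proof -
  define R :: "complex set" where "R = {\<i> * sqrt 3, - \<i> * sqrt 3}"
  have R_iff: "\<alpha> \<in> R \<longleftrightarrow> \<alpha> ^ 2 = -3" for \<alpha>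
    unfolding R_def by (rule square_minus_3_iff[symmetric])
  have not_iso: "\<not> tree_iso (shabat9 \<alpha>) (crit_value \<alpha>) 0 (shabat9 (- \<alpha>)) (crit_value (- \<alpha>)) 0"
    if "\<alpha> \<in> R" for \<alpha>
  proof -
    have \<alpha>: "\<alpha> ^ 2 = -3" using that R_iff by simp
    show ?thesis
      using not_tree_iso_mirror[OF shabat_shabat9[OF \<alpha>] has_passport_shabat9[OF \<alpha>]] shabat9_mirror[OF \<alpha>]
      by simp
  qed
  have classify: "\<exists>\<alpha>\<in>R. shabat_equiv (shabat9 \<alpha>) (crit_value \<alpha>) 0 Q d1 d2"
    if "shabat Q d1 d2" "has_passport Q d1 d2 {#3, 3, 1, 1, 1#} {#2, 2, 2, 2, 1#} 9" for Q d1 d2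
    using shabat9_classification[OF that] R_iff by metis
  have iso_iff: "tree_iso (shabat9 \<alpha>) (crit_value \<alpha>) 0 Q d1 d2 \<longleftrightarrow>
      shabat_equiv (shabat9 \<alpha>) (crit_value \<alpha>) 0 Q d1 d2"
    if Q: "shabat Q d1 d2" "has_passport Q d1 d2 {#3, 3, 1, 1, 1#} {#2, 2, 2, 2, 1#} 9" and \<alpha>: "\<alpha> \<in> R"
    for Q d1 d2 \<alpha>
  proof
    have \<alpha>2: "\<alpha> ^ 2 = -3" using \<alpha> R_iff by simp
    show "shabat_equiv (shabat9 \<alpha>) (crit_value \<alpha>) 0 Q d1 d2"
      if iso: "tree_iso (shabat9 \<alpha>) (crit_value \<alpha>) 0 Q d1 d2"
    proof -
      obtain \<beta> where \<beta>: "\<beta> \<in> R" "shabat_equiv (shabat9 \<beta>) (crit_value \<beta>) 0 Q d1 d2"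
        using classify[OF Q] by blast
      have "tree_iso Q d1 d2 (shabat9 \<beta>) (crit_value \<beta>) 0"
        by (rule shabat_equiv_imp_tree_iso[OF Q(1) shabat_equiv_sym[OF \<beta>(2)]])
      then have "tree_iso (shabat9 \<alpha>) (crit_value \<alpha>) 0 (shabat9 \<beta>) (crit_value \<beta>) 0"
        by (rule tree_iso_trans[OF iso])
      \<comment> \<open>The opposite sign would make the tree for \<alpha> isomorphic to its mirror
        image.\<close>
      then have "\<beta> \<noteq> - \<alpha>" using not_iso[OF \<alpha>] by blast
      then have "\<beta> = \<alpha>" using \<alpha> \<beta>(1) by (auto simp: R_def)
      then show ?thesis using \<beta>(2) by simp
    qed
    show "tree_iso (shabat9 \<alpha>) (crit_value \<alpha>) 0 Q d1 d2"
      if "shabat_equiv (shabat9 \<alpha>) (crit_value \<alpha>) 0 Q d1 d2"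
      by (rule shabat_equiv_imp_tree_iso[OF shabat_shabat9[OF \<alpha>2] that])
  qed
  show ?thesis
    unfolding R_def[symmetric]
  proof (intro exI[of _ crit_value] conjI ballI allI impI)
    fix \<alpha> assume "\<alpha> \<in> R"
    then have \<alpha>: "\<alpha> ^ 2 = -3" using R_iff by simp
    show "shabat (shabat9 \<alpha>) (crit_value \<alpha>) 0" by (rule shabat_shabat9[OF \<alpha>])
    show "has_passport (shabat9 \<alpha>) (crit_value \<alpha>) 0 {#3, 3, 1, 1, 1#} {#2, 2, 2, 2, 1#} 9"
      by (rule has_passport_shabat9[OF \<alpha>])
  next
    show "\<not> tree_iso (shabat9 (\<i> * sqrt 3)) (crit_value (\<i> * sqrt 3)) 0
        (shabat9 (- \<i> * sqrt 3)) (crit_value (- \<i> * sqrt 3)) 0"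
      using not_iso[of "\<i> * sqrt 3"] by (simp add: R_def)
  qed (use classify iso_iff in blast)+
qed

end
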